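(* For every integer $n \ge 12$, with $P_{n,H}(k) := P(|S-S| = k)$ where $S$ is a uniformly random subset of $[n]=\{0,1,\dots,n-1\}$, we have \[ P_{n,H}(3) > P_{n,H}(5) < P_{n,H}(7),\qquad P_{n,H}(7) > P_{n,H}(9) < P_{n,H}(11),\qquad P_{n,H}(13) > P_{n,H}(15) < P_{n,H}(17). \]
   Context: For a positive integer $n$, $[n] := \{0,1,\dots,n-1\}$, and $S$ is chosen uniformly at random among all $2^n$ subsets of $[n]$ (equivalently, each element is included independently with probability $1/2$). The difference set is $S-S := \{x-y : x,y \in S\}$, and $|A|$ denotes the cardinality of a set $A$. *)

theory Defs
  imports "HOL-Probability.Probability"
begin

definition diff_set :: "int set \<Rightarrow> int set"
  where "diff_set S = {x - y | x y. x \<in> S \<and> y \<in> S}"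

definition P_H :: "nat \<Rightarrow> nat \<Rightarrow> real"
  where "P_H n k =
    measure_pmf.prob (pmf_of_set (Pow {0..<int n})) {S. card (diff_set S) = k}"

end

theory Submission
  imports Defs
begin

text \<open>
  Up to translation, a set with at least two elements is a frame \<^term>\<open>insert 0 (insert m A)\<close> with
  \<^term>\<open>A \<subseteq> {0<..<m}\<close>, and \<^term>\<open>card (diff_set S) = 2 * k + 1\<close> means that \<open>S\<close> has \<open>k\<close> positive
  differences. If \<open>E k m\<close> is the number of frames of width \<open>m\<close> with \<open>k\<close> positive differences, then
  \<open>2 ^ n * P_H n (2 * k + 1)\<close> is the sum of \<open>(n - m) * E k m\<close> over \<open>0 < m < n\<close>. So it suffices to
  compare \<open>E k m\<close> termwise for \<open>m \<ge> 12\<close> and to know its values for \<open>m < 12\<close>.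

  For \<open>m \<ge> 28\<close> the comparison follows from growth rates: \<open>E 3\<close> and \<open>E 5\<close> grow at least like \<open>m\<close>, but
  \<open>E 4\<close> only like \<open>m / 2\<close>; \<open>E 6\<close> and \<open>E 8\<close> grow quadratically (generic four-element frames, and
  frames \<open>{0, a, m - a, m}\<close> with one generic further point), but \<open>E 7\<close> only linearly. The latter
  holds because seven positive differences on at least five points force so many linear relations
  that the frame lies in one of finitely many one-parameter families or is one of finitely many
  sporadic sets, up to dilation. For \<open>m < 28\<close> the numbers \<open>E k m\<close> are computed by a pruned search.
\<close>

section \<open>Reduction to frames\<close>

definition pos_diffs :: "int set \<Rightarrow> int set"
  where "pos_diffs S = {x - y | x y. x \<in> S \<and> y \<in> S \<and> y < x}"

definition framed :: "nat \<Rightarrow> int \<Rightarrow> int set set"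
  where "framed k m = {A. A \<subseteq> {0<..<m} \<and> card (pos_diffs (insert 0 (insert m A))) = k}"

section \<open>Positive differences under translation and insertion, and those of a frame\<close>

lemma in_pos_diffs_iff: "d \<in> pos_diffs S \<longleftrightarrow> 0 < d \<and> (\<exists>y \<in> S. y + d \<in> S)"
proof
  assume "d \<in> pos_diffs S"
  then obtain x y where xy: "d = x - y" "x \<in> S" "y \<in> S" "y < x"
    unfolding pos_diffs_def by auto
  then have "y + d \<in> S" "0 < d" by auto
  then show "0 < d \<and> (\<exists>y \<in> S. y + d \<in> S)" using xy(3) by blast
next
  assume "0 < d \<and> (\<exists>y \<in> S. y + d \<in> S)"
  then obtain y where "d = (y + d) - y" "y + d \<in> S" "y \<in> S" "y < y + d" by auto
  then show "d \<in> pos_diffs S" unfolding pos_diffs_def by blast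
qed

lemma pos_diffs_mono: "S \<subseteq> T \<Longrightarrow> pos_diffs S \<subseteq> pos_diffs T"
  unfolding pos_diffs_def by blast

lemma pos_diffs_positive: "d \<in> pos_diffs S \<Longrightarrow> 0 < d"
  unfolding pos_diffs_def by auto

lemma finite_pos_diffs [intro]: "finite S \<Longrightarrow> finite (pos_diffs S)"
proof -
  assume "finite S"
  then have "finite ((\<lambda>(x, y). x - y) ` (S \<times> S))" by blast
  moreover have "pos_diffs S \<subseteq> (\<lambda>(x, y). x - y) ` (S \<times> S)"
    unfolding pos_diffs_def by force
  ultimately show ?thesis by (rule rev_finite_subset)
qed

lemma pos_diffs_translate: "pos_diffs ((+) c ` S) = pos_diffs S"
  by (rule set_eqI) (simp add: in_pos_diffs_iff add.assoc image_iff)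

lemma pos_diffs_insert_upper:
  assumes "\<And>t. t \<in> T \<Longrightarrow> t < x"
  shows "pos_diffs (insert x T) = pos_diffs T \<union> (\<lambda>t. x - t) ` T"
proof (rule set_eqI)
  fix d
  show "d \<in> pos_diffs (insert x T) \<longleftrightarrow> d \<in> pos_diffs T \<union> (\<lambda>t. x - t) ` T"
  proof
    assume "d \<in> pos_diffs (insert x T)"
    then obtain y where y: "0 < d" "y \<in> insert x T" "y + d \<in> insert x T"
      unfolding in_pos_diffs_iff by blast
    have "x + d \<notin> T" using assms[of "x + d"] y(1) by auto
    then have "y \<in> T" using y by auto
    then show "d \<in> pos_diffs T \<union> (\<lambda>t. x - t) ` T"
      using y unfolding Un_iff in_pos_diffs_iff image_iff by force
  next
    assume "d \<in> pos_diffs T \<union> (\<lambda>t. x - t) ` T"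
    then show "d \<in> pos_diffs (insert x T)"
      using assms unfolding Un_iff in_pos_diffs_iff image_iff by force
  qed
qed

lemma pos_diffs_frame:
  assumes "A \<subseteq> {0<..<m}" "0 < m"
  shows "pos_diffs (insert 0 (insert m A)) = insert m (A \<union> (-) m ` A \<union> pos_diffs A)"
proof -
  have A: "0 < x \<and> x < m" if "x \<in> A" for x
    using assms that by auto
  show ?thesis
  proof (rule set_eqI)
    fix d
    show "d \<in> pos_diffs (insert 0 (insert m A)) \<longleftrightarrow>
        d \<in> insert m (A \<union> (-) m ` A \<union> pos_diffs A)"
    proof
      assume "d \<in> pos_diffs (insert 0 (insert m A))"
      then obtain x y where "d = x - y" "x \<in> insert 0 (insert m A)"
        "y \<in> insert 0 (insert m A)" "y < x"
        unfolding pos_diffs_def by blast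
      then show "d \<in> insert m (A \<union> (-) m ` A \<union> pos_diffs A)"
        using A assms(2) unfolding pos_diffs_def by (auto dest: less_asym)
    next
      assume "d \<in> insert m (A \<union> (-) m ` A \<union> pos_diffs A)"
      then consider "d = m - 0" | "d = d - 0" "d \<in> A" | x where "x \<in> A" "d = m - x"
        | "d \<in> pos_diffs A"
        by auto
      then show "d \<in> pos_diffs (insert 0 (insert m A))"
      proof cases
        case 4
        then show ?thesis using pos_diffs_mono[of A "insert 0 (insert m A)"] by blast
      qed (use A assms(2) in \<open>unfold pos_diffs_def, blast+\<close>)
    qed
  qed
qed

text \<open>The difference set is symmetric about 0, so it is the disjoint union of 0, the positive
  differences and their negatives.\<close>

lemma card_diff_set:
  assumes "finite S" "S \<noteq> {}"
  shows "card (diff_set S) = 2 * card (pos_diffs S) + 1"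
proof -
  let ?D = "pos_diffs S"
  have eq: "diff_set S = insert 0 (?D \<union> uminus ` ?D)"
  proof (rule set_eqI)
    fix d
    show "d \<in> diff_set S \<longleftrightarrow> d \<in> insert 0 (?D \<union> uminus ` ?D)"
    proof
      assume "d \<in> diff_set S"
      then obtain x y where xy: "d = x - y" "x \<in> S" "y \<in> S"
        unfolding diff_set_def by blast
      consider "x = y" | "y < x" | "x < y" by linarith
      then show "d \<in> insert 0 (?D \<union> uminus ` ?D)"
      proof cases
        case 3
        then have "y - x \<in> ?D" using xy unfolding pos_diffs_def by blast
        then have "- (y - x) \<in> uminus ` ?D" by (rule imageI)
        then show ?thesis using xy by simp
      qed (use xy in \<open>auto simp: pos_diffs_def\<close>)
    next
      obtain z where "z \<in> S" using assms(2) by blast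
      then have "0 \<in> diff_set S" unfolding diff_set_def by force
      moreover assume "d \<in> insert 0 (?D \<union> uminus ` ?D)"
      ultimately show "d \<in> diff_set S"
        unfolding diff_set_def pos_diffs_def by force
    qed
  qed
  have fin: "finite ?D" using assms(1) by blast
  have "?D \<inter> uminus ` ?D = {}"
  proof (rule ccontr)
    assume "?D \<inter> uminus ` ?D \<noteq> {}"
    then obtain d where "d \<in> ?D" "- d \<in> ?D" by auto
    then show False using pos_diffs_positive[of d S] pos_diffs_positive[of "- d" S] by simp
  qed
  then have "card (?D \<union> uminus ` ?D) = 2 * card ?D"
    using fin by (simp add: card_Un_disjoint card_image)
  moreover have "0 \<notin> ?D \<union> uminus ` ?D"
    using pos_diffs_positive[of 0 S] by auto
  ultimately show ?thesis using fin unfolding eq by simp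
qed

section \<open>Counting subsets by width and position\<close>

lemma finite_framed: "finite (framed k m)"
  by (rule finite_subset[of _ "Pow {0<..<m}"]) (auto simp: framed_def)

text \<open>A set with a positive difference is determined by its minimum \<open>i\<close>, its
  width \<open>m\<close> and its interior points shifted by \<open>i\<close>. Translation preserves
  differences, and a frame of width \<open>m\<close> has \<open>n - m\<close> positions in
  \<open>{0..<int n}\<close>. The assumption \<open>0 < k\<close> excludes singletons, which have no
  width.\<close>

lemma card_subsets_eq_sum_framed:
  assumes "0 < k"
  shows "card {S \<in> Pow {0..<int n}. card (diff_set S) = 2 * k + 1} =
    (\<Sum>m = 1..<n. (n - m) * card (framed k (int m)))"
proof -
  let ?I = "SIGMA m : {1..<n}. {0..<int (n - m)} \<times> framed k (int m)"
  let ?f = "\<lambda>(m, i, A). (+) i ` insert 0 (insert (int m) A)"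
  let ?F = "{S \<in> Pow {0..<int n}. card (diff_set S) = 2 * k + 1}"
  \<comment> \<open>The minimum and maximum of the translated frame recover \<open>i\<close> and
    \<open>m\<close>, which is what injectivity needs.\<close>
  have ends: "Min (?f (m, i, A)) = i \<and> Max (?f (m, i, A)) = i + int m
      \<and> finite (?f (m, i, A))"
    if "(m, i, A) \<in> ?I" for m i A
  proof -
    have sub: "A \<subseteq> {0<..<int m}" and pos: "0 < int m"
      using that by (auto simp: framed_def)
    have fin: "finite (?f (m, i, A))" using finite_subset[OF sub] by simp
    have "Min (?f (m, i, A)) = i"
      using fin sub pos by (intro Min_eqI) auto
    moreover have "Max (?f (m, i, A)) = i + int m"
      using fin sub pos by (intro Max_eqI) auto
    ultimately show ?thesis using fin by blast
  qed
  have inj: "inj_on ?f ?I"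
  proof (rule inj_onI, clarify, goal_cases)
    case (1 m i A m' i' A')
    then have t: "(m, i, A) \<in> ?I" "(m', i', A') \<in> ?I" by auto
    have eq: "?f (m, i, A) = ?f (m', i', A')" using 1 by simp
    have i: "i' = i" using ends[OF t(1)] ends[OF t(2)] eq by metis
    have m: "m' = m" using ends[OF t(1)] ends[OF t(2)] eq i by (metis add_left_cancel of_nat_eq_iff)
    have "inj ((+) i)" by simp
    then have "insert 0 (insert (int m) A) = insert 0 (insert (int m) A')"
      using eq unfolding i m by (simp only: prod.case inj_image_eq_iff)
    moreover have "A \<subseteq> {0<..<int m}" "A' \<subseteq> {0<..<int m}"
      using 1 m by (auto simp: framed_def)
    then have "A = insert 0 (insert (int m) A) - {0, int m}"
      "A' = insert 0 (insert (int m) A') - {0, int m}"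
      by auto
    ultimately have "A = A'" by simp
    then show ?case using i m by simp
  qed
  have img: "?f ` ?I = ?F"
  proof (intro set_eqI iffI)
    fix S assume "S \<in> ?f ` ?I"
    then obtain z where z: "z \<in> ?I" "S = ?f z" by blast
    obtain m i A where "z = (m, i, A)" by (cases z)
    then have t: "(m, i, A) \<in> ?I" and S: "S = ?f (m, i, A)" using z by (simp_all only:)
    have sub: "A \<subseteq> {0<..<int m}" and m: "0 < int m" "m < n" and i: "0 \<le> i" "i < int (n - m)"
      and k: "card (pos_diffs (insert 0 (insert (int m) A))) = k"
      using t by (auto simp: framed_def)
    have "S \<subseteq> {0..<int n}" using sub m i unfolding S by auto
    moreover have "card (diff_set S) = 2 * k + 1"
      using card_diff_set[of S] ends[OF t] k unfolding S by (simp only: prod.case pos_diffs_translate) blast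
    ultimately show "S \<in> ?F" by blast
  next
    fix S assume S: "S \<in> ?F"
    have fin: "finite S" using S by (auto intro: finite_subset)
    have ne: "S \<noteq> {}" using S by (auto simp: diff_set_def)
    have kS: "card (pos_diffs S) = k" using S card_diff_set[OF fin ne] by simp
    define i where "i = Min S"
    define m where "m = nat (Max S - Min S)"
    define A where "A = (\<lambda>x. x - i) ` (S - {Min S, Max S})"
    have mem: "Min S \<in> S" "Max S \<in> S" using fin ne by auto
    have bd: "Min S \<le> x" "x \<le> Max S" if "x \<in> S" for x using fin that by auto
    have "pos_diffs S \<noteq> {}" using kS assms by auto
    then obtain x y where "x \<in> S" "y \<in> S" "y < x" unfolding pos_diffs_def by blast
    then have lt: "Min S < Max S" using bd by fastforce
    have mM: "int m = Max S - Min S" using lt by (simp add: m_def)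
    have Seq: "S = ?f (m, i, A)"
      using mem lt by (auto simp: A_def i_def mM image_image)
    have "0 \<le> Min S" "Max S < int n" using S mem by auto
    moreover have sub: "A \<subseteq> {0<..<int m}"
    proof
      fix z assume "z \<in> A"
      then obtain x where "x \<in> S" "x \<noteq> Min S" "x \<noteq> Max S" "z = x - i" by (auto simp: A_def)
      then show "z \<in> {0<..<int m}" using bd[of x] by (auto simp: mM i_def)
    qed
    moreover have "card (pos_diffs (insert 0 (insert (int m) A))) = k"
      using kS by (subst (asm) Seq) (simp only: prod.case pos_diffs_translate)
    ultimately have "(m, i, A) \<in> ?I"
      using lt mM by (auto simp: framed_def i_def)
    then show "S \<in> ?f ` ?I" by (rule image_eqI[where f = ?f, OF Seq])
  qed
  have "card ?F = card ?I" using card_image[OF inj] img by simp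
  also have "\<dots> = (\<Sum>m = 1..<n. (n - m) * card (framed k (int m)))"
    by (simp add: card_SigmaI finite_framed card_cartesian_product nat_minus_as_int)
  finally show ?thesis .
qed

lemma P_H_eq:
  assumes "0 < k"
  shows "P_H n (2 * k + 1) = real (\<Sum>m = 1..<n. (n - m) * card (framed k (int m))) / 2 ^ n"
proof -
  have "Pow {0..<int n} \<inter> {S. card (diff_set S) = 2 * k + 1}
      = {S \<in> Pow {0..<int n}. card (diff_set S) = 2 * k + 1}"
    by blast
  then show ?thesis
    unfolding P_H_def using card_subsets_eq_sum_framed[OF assms, of n]
    by (subst measure_pmf_of_set) (auto simp: card_Pow simp del: of_nat_sum)
qed

text \<open>For \<open>m < 12\<close> the weight splits as
  \<open>n - m = (12 - m) + (n - 12)\<close>. The counts for small widths therefore enter only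
  through two sums independent of \<open>n\<close>: the weighted sum belonging to
  \<open>n = 12\<close>, which gives strictness, and the plain total, which is multiplied by
  \<open>n - 12\<close>.\<close>

lemma P_H_less:
  assumes "12 \<le> n" "0 < k" "0 < l"
    and tail: "\<And>m. 12 \<le> m \<Longrightarrow> card (framed l (int m)) \<le> card (framed k (int m))"
    and total: "(\<Sum>m = 1..<12. card (framed l (int m))) \<le> (\<Sum>m = 1..<12. card (framed k (int m)))"
    and weighted: "(\<Sum>m = 1..<12. (12 - m) * card (framed l (int m)))
      < (\<Sum>m = 1..<12. (12 - m) * card (framed k (int m)))"
  shows "P_H n (2 * l + 1) < P_H n (2 * k + 1)"
proof -
  have split: "(\<Sum>m = 1..<n. (n - m) * c m) =
      (\<Sum>m = 1..<12. (12 - m) * c m) + (n - 12) * (\<Sum>m = 1..<12. c m)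
      + (\<Sum>m = 12..<n. (n - m) * c m)" for c :: "nat \<Rightarrow> nat"
  proof -
    have "(\<Sum>m = 1..<n. (n - m) * c m) =
        (\<Sum>m = 1..<12. (n - m) * c m) + (\<Sum>m = 12..<n. (n - m) * c m)"
      using assms(1) by (simp add: sum.atLeastLessThan_concat)
    also have "(\<Sum>m = 1..<12. (n - m) * c m) =
        (\<Sum>m = 1..<12. (12 - m) * c m + (n - 12) * c m)"
      using assms(1) by (intro sum.cong) (auto simp flip: add_mult_distrib)
    finally show ?thesis by (simp only: sum.distrib sum_distrib_left)
  qed
  have "(\<Sum>m = 12..<n. (n - m) * card (framed l (int m)))
      \<le> (\<Sum>m = 12..<n. (n - m) * card (framed k (int m)))"
    using tail by (intro sum_mono) auto
  moreover have "(n - 12) * (\<Sum>m = 1..<12. card (framed l (int m)))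
      \<le> (n - 12) * (\<Sum>m = 1..<12. card (framed k (int m)))"
    using total by (rule mult_le_mono2)
  ultimately have "(\<Sum>m = 1..<n. (n - m) * card (framed l (int m)))
      < (\<Sum>m = 1..<n. (n - m) * card (framed k (int m)))"
    unfolding split using weighted by linarith
  then have "real (\<Sum>m = 1..<n. (n - m) * card (framed l (int m)))
      < real (\<Sum>m = 1..<n. (n - m) * card (framed k (int m)))"
    by (simp only: of_nat_less_iff)
  then show ?thesis
    unfolding P_H_eq[OF assms(2)] P_H_eq[OF assms(3)] by (rule divide_strict_right_mono) simp
qed

section \<open>Counting frames by search\<close>

text \<open>
  A bit list represents the set of positive integers \<open>i + 1\<close> such that bit \<open>i\<close> is set. When the search
  reaches the position \<open>x\<close>, the list \<open>S\<close> holds the elements chosen so far as distances from \<open>x\<close>, the list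
  \<open>U\<close> holds the single distance \<open>m - x\<close>, and \<open>D\<close> the differences so far; hence adding \<open>x\<close> turns \<open>D\<close> into
  the union of the three.
\<close>

fun bit_union :: "bool list \<Rightarrow> bool list \<Rightarrow> bool list" where
  "bit_union [] ys = ys"
| "bit_union (x # xs) [] = x # xs"
| "bit_union (x # xs) (y # ys) = (if x then True else y) # bit_union xs ys"

text \<open>The part of the allowance \<open>k\<close> left after counting the set bits; the scan
  stops with \<open>None\<close> as soon as it is exceeded.\<close>

fun budget :: "nat \<Rightarrow> bool list \<Rightarrow> nat option" where
  "budget k [] = Some k"
| "budget k (False # xs) = budget k xs"
| "budget 0 (True # xs) = None"
| "budget (Suc k) (True # xs) = budget k xs"

fun top_bit :: "nat \<Rightarrow> bool list" where
  "top_bit 0 = []"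
| "top_bit (Suc 0) = [True]"
| "top_bit (Suc (Suc n)) = False # top_bit (Suc n)"

text \<open>The branch that adds the current position is cut when \<open>D'\<close> exceeds the
  budget, because differences never disappear when elements are added.\<close>

fun count_extensions :: "nat \<Rightarrow> bool list \<Rightarrow> bool list \<Rightarrow> bool list \<Rightarrow> int" where
  "count_extensions k [] S D = (if budget k D = Some 0 then 1 else 0)"
| "count_extensions k (u # U) S D =
    (let D' = bit_union D (bit_union S (u # U)) in
      case budget k D' of
        None \<Rightarrow> count_extensions k U (False # S) D
      | Some r \<Rightarrow> count_extensions k U (True # S) D' + count_extensions k U (False # S) D)"

text \<open>The search starts at position 1: the element 0 lies at distance 1, the end point at
  distance \<open>m - 1\<close>, and \<open>m\<close> is the only difference so far.\<close>

definition count_framed :: "nat \<Rightarrow> nat \<Rightarrow> int"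
  where "count_framed k m = count_extensions k (top_bit (m - 1)) [True] (top_bit m)"

fun bit_set :: "bool list \<Rightarrow> int set" where
  "bit_set [] = {}"
| "bit_set (b # bs) = (if b then {1} else {}) \<union> (+) 1 ` bit_set bs"

section \<open>Correctness of the search\<close>

lemma finite_bit_set: "finite (bit_set bs)"
  by (induction bs) auto

lemma bit_set_positive: "d \<in> bit_set bs \<Longrightarrow> 0 < d"
  by (induction bs arbitrary: d) (force split: if_splits)+

lemma bit_set_bit_union: "bit_set (bit_union xs ys) = bit_set xs \<union> bit_set ys"
  by (induction xs ys rule: bit_union.induct) auto

lemma bit_set_top_bit: "bit_set (top_bit (Suc n)) = {int n + 1}"
  by (induction n) auto

lemma card_bit_set_Cons: "card (bit_set (b # bs)) = of_bool b + card (bit_set bs)"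
proof -
  have "1 \<notin> (+) 1 ` bit_set bs" using bit_set_positive[of 0 bs] by auto
  then show ?thesis by (simp add: finite_bit_set card_image)
qed

lemma budget_eq:
  "budget k bs = (if card (bit_set bs) \<le> k then Some (k - card (bit_set bs)) else None)"
proof (induction k bs rule: budget.induct)
  case (1 k)
  then show ?case by simp
next
  case (2 k xs)
  then show ?case using card_bit_set_Cons[of False xs] by simp
next
  case (3 xs)
  then show ?case using card_bit_set_Cons[of True xs] by simp
next
  case (4 k xs)
  then show ?case using card_bit_set_Cons[of True xs] by simp
qed

lemma top_bit_Suc: "\<exists>u. top_bit (Suc n) = u # top_bit n"
  by (cases n) auto

text \<open>Induction on the number \<open>n\<close> of positions left before \<open>m\<close>.
  \<open>T\<close> is the part of the frame chosen below \<open>x\<close>; the last two assumptions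
  are the invariant of the search.\<close>

lemma count_extensions_correct:
  assumes "T \<subseteq> {0..<x}" "0 < x" "x + int n = m"
    and "bit_set S = (\<lambda>t. x - t) ` T"
    and "bit_set D = pos_diffs (insert m T)"
  shows "count_extensions k (top_bit n) S D =
    int (card {B. B \<subseteq> {x..<m} \<and> card (pos_diffs (insert m T \<union> B)) = k})"
  using assms
proof (induction n arbitrary: T x S D)
  case 0
  then have "{B. B \<subseteq> {x..<m} \<and> card (pos_diffs (insert m T \<union> B)) = k} =
      (if card (bit_set D) = k then {{}} else {})"
    by auto
  then show ?case by (simp add: budget_eq)
next
  case (Suc n)
  let ?F = "\<lambda>x T. {B. B \<subseteq> {x..<m} \<and> card (pos_diffs (insert m T \<union> B)) = k}"
  obtain u where u: "top_bit (Suc n) = u # top_bit n" using top_bit_Suc by blast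
  have gap: "int n + 1 = m - x" using Suc.prems(3) by simp
  have x: "x < m" using Suc.prems(3) by simp
  have ivl: "{x..<m} = insert x {x + 1..<m}" "x \<notin> {x + 1..<m}" using x by auto
  have T: "finite T" "x \<notin> T" using Suc.prems(1) by (auto intro: finite_subset)
  define D' where "D' = bit_union D (bit_union S (top_bit (Suc n)))"
  have Tm: "t < m" if "t \<in> T" for t using that Suc.prems(1) x by auto
  have Tx: "t < x" if "t \<in> T" for t using that Suc.prems(1) by auto
  \<comment> \<open>Inserting from below, first \<open>x\<close> and then \<open>m\<close>, isolates
    the new differences: the distances \<open>x - t\<close> stored in \<open>S\<close> and the
    single distance \<open>m - x\<close>.\<close>
  have "pos_diffs (insert m (insert x T)) = pos_diffs (insert x T) \<union> (\<lambda>t. m - t) ` insert x T"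
    using Tm x by (intro pos_diffs_insert_upper) auto
  also have "pos_diffs (insert x T) = pos_diffs T \<union> (\<lambda>t. x - t) ` T"
    using Tx by (rule pos_diffs_insert_upper)
  also have "pos_diffs T \<union> (\<lambda>t. x - t) ` T \<union> (\<lambda>t. m - t) ` insert x T =
      (pos_diffs T \<union> (\<lambda>t. m - t) ` T) \<union> ((\<lambda>t. x - t) ` T \<union> {m - x})"
    by auto
  also have "pos_diffs T \<union> (\<lambda>t. m - t) ` T = pos_diffs (insert m T)"
    using Tm by (rule pos_diffs_insert_upper[symmetric])
  finally have D': "bit_set D' = pos_diffs (insert m (insert x T))"
    using gap unfolding D'_def bit_set_bit_union bit_set_top_bit Suc.prems(4,5) by simp
  have skip: "count_extensions k (top_bit n) (False # S) D = int (card (?F (x + 1) T))"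
    using Suc.prems by (intro Suc.IH) (auto simp: image_image algebra_simps)
  have take: "count_extensions k (top_bit n) (True # S) D' = int (card (?F (x + 1) (insert x T)))"
    using Suc.prems D' by (intro Suc.IH) (auto simp: image_image algebra_simps)
  \<comment> \<open>An extension either avoids \<open>x\<close> or arises from an extension of
    \<open>insert x T\<close> by adding \<open>x\<close>.\<close>
  have "?F x T = ?F (x + 1) T \<union> insert x ` ?F (x + 1) (insert x T)"
  proof (intro set_eqI iffI)
    fix B assume B: "B \<in> ?F x T"
    show "B \<in> ?F (x + 1) T \<union> insert x ` ?F (x + 1) (insert x T)"
    proof (cases "x \<in> B")
      case True
      then have "B = insert x (B - {x})" "insert m T \<union> B = insert m (insert x T) \<union> (B - {x})"
        by auto
      moreover have "B - {x} \<subseteq> {x + 1..<m}" using B ivl by blast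
      ultimately have "B - {x} \<in> ?F (x + 1) (insert x T)" using B by simp
      then show ?thesis using \<open>B = insert x (B - {x})\<close> by blast
    next
      case False
      then have "B \<subseteq> {x + 1..<m}" using B ivl(1) by (simp add: subset_insert)
      then show ?thesis using B by simp
    qed
  next
    fix B assume "B \<in> ?F (x + 1) T \<union> insert x ` ?F (x + 1) (insert x T)"
    then show "B \<in> ?F x T"
    proof
      assume "B \<in> ?F (x + 1) T"
      then show ?thesis using ivl(1) by auto
    next
      assume "B \<in> insert x ` ?F (x + 1) (insert x T)"
      then obtain C where C: "B = insert x C" "C \<subseteq> {x + 1..<m}"
        "card (pos_diffs (insert m (insert x T) \<union> C)) = k" by blast
      moreover have "insert m T \<union> B = insert m (insert x T) \<union> C" using C(1) by blast
      moreover have "B \<subseteq> {x..<m}" using C(1,2) ivl by blast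
      ultimately show ?thesis by simp
    qed
  qed
  moreover have "?F (x + 1) T \<inter> insert x ` ?F (x + 1) (insert x T) = {}" using ivl(2) by blast
  moreover have "inj_on (insert x) (?F (x + 1) (insert x T))"
  proof (rule inj_onI)
    fix B C assume "B \<in> ?F (x + 1) (insert x T)" "C \<in> ?F (x + 1) (insert x T)"
    then have "x \<notin> B" "x \<notin> C" using ivl(2) by blast+
    moreover assume "insert x B = insert x C"
    ultimately show "B = C" by (metis insert_ident)
  qed
  moreover have fin: "finite (?F y T')" for y T'
    by (rule finite_subset[of _ "Pow {y..<m}"]) auto
  ultimately have split: "card (?F x T) = card (?F (x + 1) T) + card (?F (x + 1) (insert x T))"
    by (simp only: card_Un_disjoint finite_imageI card_image)
  \<comment> \<open>By monotonicity of \<open>pos_diffs\<close>, a partial frame with too many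
    differences has no admissible extension.\<close>
  have prune: "?F (x + 1) (insert x T) = {}" if big: "k < card (bit_set D')"
  proof -
    have "k < card (pos_diffs (insert m (insert x T) \<union> B))" if "B \<subseteq> {x + 1..<m}" for B
    proof -
      have "finite (insert m (insert x T) \<union> B)" using T that by (auto intro: finite_subset)
      then have "card (pos_diffs (insert m (insert x T)))
          \<le> card (pos_diffs (insert m (insert x T) \<union> B))"
        by (intro card_mono finite_pos_diffs pos_diffs_mono) auto
      then show ?thesis using big D' by simp
    qed
    then show ?thesis by (blast dest: less_imp_neq)
  qed
  have step: "count_extensions k (top_bit (Suc n)) S D =
      (case budget k D' of None \<Rightarrow> count_extensions k (top_bit n) (False # S) D
       | Some r \<Rightarrow> count_extensions k (top_bit n) (True # S) D'
           + count_extensions k (top_bit n) (False # S) D)"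
    unfolding D'_def u by (simp only: count_extensions.simps Let_def)
  show ?case
  proof (cases "card (bit_set D') \<le> k")
    case True
    then have "budget k D' = Some (k - card (bit_set D'))" by (simp add: budget_eq)
    then show ?thesis
      unfolding step split skip take by (simp only: option.case of_nat_add add.commute)
  next
    case False
    then have "budget k D' = None" and "?F (x + 1) (insert x T) = {}"
      using prune by (simp_all add: budget_eq)
    then show ?thesis
      unfolding step split skip by (simp only: option.case card.empty add_0_right)
  qed
qed

lemma card_framed_eq_count:
  assumes "0 < m"
  shows "int (card (framed k (int m))) = count_framed k m"
proof -
  have "pos_diffs (insert (int m) {0}) = {int m}"
    using pos_diffs_insert_upper[of "{0}" "int m"] assms by (auto simp: pos_diffs_def)
  moreover have "bit_set (top_bit m) = {int m}"
    using bit_set_top_bit[of "m - 1"] assms by simp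
  ultimately have "count_framed k m =
      int (card {B. B \<subseteq> {1..<int m} \<and> card (pos_diffs (insert (int m) {0} \<union> B)) = k})"
    unfolding count_framed_def using assms
    by (intro count_extensions_correct) auto
  also have "{B. B \<subseteq> {1..<int m} \<and> card (pos_diffs (insert (int m) {0} \<union> B)) = k}
      = framed k (int m)"
  proof -
    have "{1..<int m} = {0<..<int m}" by auto
    moreover have "insert (int m) {0} \<union> B = insert 0 (insert (int m) B)" for B by auto
    ultimately show ?thesis unfolding framed_def by simp
  qed
  finally show ?thesis by simp
qed

section \<open>Frames with few differences\<close>

text \<open>The pair \<open>(k, C)\<close> stands for the subset \<open>C\<close> of \<open>{0<..<k}\<close> rescaled to width \<open>m\<close>.\<close>

definition dilate :: "int \<Rightarrow> int \<times> int list \<Rightarrow> int set"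
  where "dilate m = (\<lambda>(k, C). (\<lambda>c. c * m div k) ` set C)"

text \<open>The suffix counts the points of the whole frame, so each list holds two fewer. These are
  the shapes left over in the classification beside the linear families.\<close>

definition sporadic_5 :: "(int \<times> int list) list" where
  "sporadic_5 = [(7, [1, 2, 4]), (7, [3, 5, 6]), (8, [1, 2, 4]), (8, [2, 3, 4]),
    (8, [2, 4, 5]), (8, [3, 4, 6]), (8, [4, 5, 6]), (8, [4, 6, 7])]"

definition sporadic_6 :: "(int \<times> int list) list" where
  "sporadic_6 = [(6, [1, 2, 3, 4]), (6, [1, 2, 3, 5]), (6, [1, 3, 4, 5]), (6, [2, 3, 4, 5]),
    (7, [1, 2, 3, 4]), (7, [1, 2, 3, 5]), (7, [1, 2, 3, 6]), (7, [1, 2, 4, 5]), (7, [1, 2, 4, 6]),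
    (7, [1, 3, 4, 5]), (7, [1, 3, 5, 6]), (7, [1, 4, 5, 6]), (7, [2, 3, 4, 6]), (7, [2, 3, 5, 6]),
    (7, [2, 4, 5, 6]), (7, [3, 4, 5, 6]), (8, [1, 3, 4, 5]), (8, [2, 3, 4, 5]), (8, [2, 3, 4, 6]),
    (8, [2, 4, 5, 6]), (8, [3, 4, 5, 6]), (8, [3, 4, 5, 7]), (9, [3, 4, 5, 6])]"

definition sporadic_7 :: "(int \<times> int list) list" where
  "sporadic_7 = [(6, [1, 2, 3, 4, 5]), (7, [1, 2, 3, 4, 5]), (7, [1, 2, 3, 4, 6]),
    (7, [1, 2, 3, 5, 6]), (7, [1, 2, 4, 5, 6]), (7, [1, 3, 4, 5, 6]), (7, [2, 3, 4, 5, 6]),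
    (8, [2, 3, 4, 5, 6])]"

text \<open>The assumption states \<open>xs = C * m / k\<close> with denominators cleared. All the
  divisions in \<open>dilate\<close> are then exact.\<close>

lemma dilateI:
  assumes "map ((*) k) xs = map (\<lambda>c. c * m) C" "k \<noteq> 0"
  shows "set xs = dilate m (k, C)"
proof -
  have "xs = map (\<lambda>x. x div k) (map ((*) k) xs)"
    using assms(2) by (simp add: map_idI)
  also have "\<dots> = map (\<lambda>c. c * m div k) C"
    unfolding assms(1) by simp
  finally show ?thesis by (simp add: dilate_def)
qed

lemma bex_dilateI:
  assumes "list_ex (\<lambda>(k, C). map ((*) k) xs = map (\<lambda>c. c * m) C) L" "list_all (\<lambda>(k, C). k \<noteq> 0) L"
  shows "set xs \<in> dilate m ` set L"
  using assms dilateI unfolding list_ex_iff list_all_iff by fast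

lemma card_dilates: "card (dilate m ` set L) \<le> length L"
  by (meson card_image_le card_length finite_set order_trans)

text \<open>Integers whose pairwise distances are at most \<open>m / k\<close> number at most
  \<open>m / k + 1\<close>, and an image is no larger. This bounds a one-parameter family by the
  length of its parameter interval; keeping the factor \<open>k\<close> avoids rounding.\<close>

lemma card_image_spread:
  fixes T :: "int set"
  assumes "\<And>x y. x \<in> T \<Longrightarrow> y \<in> T \<Longrightarrow> k * (x - y) \<le> m" "0 < k" "0 \<le> m"
  shows "finite (f ` T) \<and> k * int (card (f ` T)) \<le> m + k"
proof -
  have fin: "finite T"
  proof (cases "T = {}")
    case False
    then obtain y where y: "y \<in> T" by blast
    have "T \<subseteq> {y - m..y + m}"
    proof
      fix x assume "x \<in> T"
      then have "k * (x - y) \<le> m" "k * (y - x) \<le> m" using assms(1) y by auto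
      moreover have "0 \<le> d \<Longrightarrow> d \<le> k * d" for d
        using assms(2) mult_right_mono[of 1 k d] by simp
      ultimately have "x - y \<le> m" "y - x \<le> m"
        using assms(3) by (smt (verit))+
      then show "x \<in> {y - m..y + m}" by simp
    qed
    then show ?thesis by (rule finite_subset) simp
  qed simp
  have "k * int (card T) \<le> m + k"
  proof (cases "T = {}")
    case False
    have "T \<subseteq> {Min T..Max T}" using fin by auto
    then have "card T \<le> card {Min T..Max T}" by (rule card_mono[rotated]) simp
    moreover have "Min T \<le> Max T" using fin False by (meson Max_ge Min_in)
    ultimately have "int (card T) \<le> (Max T - Min T) + 1" by simp
    then have "k * int (card T) \<le> k * ((Max T - Min T) + 1)" using assms(2) by simp
    moreover have "k * (Max T - Min T) \<le> m" using fin False by (intro assms(1)) auto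
    ultimately show ?thesis by (simp add: distrib_left)
  qed (use assms in simp)
  moreover have "k * int (card (f ` T)) \<le> k * int (card T)"
    using assms(2) card_image_le[OF fin, of f] by simp
  ultimately show ?thesis using fin by simp
qed

lemma card_Un_mono: "card A \<le> a \<Longrightarrow> card B \<le> b \<Longrightarrow> card (A \<union> B) \<le> a + b"
  using card_Un_le[of A B] by linarith

lemma int_card_insert:
  "finite A \<Longrightarrow> int (card (insert x A)) = (if x \<in> A then 0 else 1) + int (card A)"
  by (simp add: card_insert_if)

lemma finite_frame: "finite A \<Longrightarrow> finite (pos_diffs (insert 0 (insert m A)))"
  by auto

section \<open>Difference sets of small frames and the linear relations forced by
  coincidences\<close>

lemma frame_0: "0 < m \<Longrightarrow> pos_diffs (insert 0 (insert m {})) = {m}"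
  by (subst pos_diffs_frame) (auto simp: pos_diffs_def)

lemma frame_1: "0 < p \<Longrightarrow> p < m \<Longrightarrow> pos_diffs (insert 0 (insert m {p})) = {p, m - p, m}"
  by (subst pos_diffs_frame) (auto simp: pos_diffs_def)

lemma frame_2:
  assumes "0 < p" "p < q" "q < m"
  shows "pos_diffs (insert 0 (insert m {p, q})) = {p, q, m - p, m - q, q - p, m}"
proof -
  have "pos_diffs {p, q} = {q - p}"
    using assms pos_diffs_insert_upper[of "{p}" q] by (auto simp: pos_diffs_def insert_commute)
  then show ?thesis using assms by (subst pos_diffs_frame) auto
qed

lemma frame_3:
  assumes "0 < p" "p < q" "q < r" "r < m"
  shows "pos_diffs (insert 0 (insert m {p, q, r})) =
    {p, q, r, m - p, m - q, m - r, q - p, r - p, r - q, m}"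
proof -
  have "pos_diffs {p, q} = {q - p}"
    using assms pos_diffs_insert_upper[of "{p}" q] by (auto simp: pos_diffs_def insert_commute)
  moreover have "pos_diffs (insert r {p, q}) = pos_diffs {p, q} \<union> (\<lambda>t. r - t) ` {p, q}"
    by (rule pos_diffs_insert_upper) (use assms in auto)
  moreover have "insert r {p, q} = {p, q, r}" by auto
  ultimately show ?thesis using assms by (subst pos_diffs_frame) auto
qed

text \<open>The width \<open>m\<close> exceeds every other difference, so the remaining five
  expressions take exactly three values. Written as a sum of equality indicators, this is a problem
  of linear arithmetic.\<close>

lemma four_element_frame_4:
  fixes m :: int
  assumes "0 < p" "p < q" "q < m"
    and "card (pos_diffs (insert 0 (insert m {p, q}))) = 4"
  shows "p + q = m \<or> (list_ex (\<lambda>(k, C). map ((*) k) [p, q] = map (\<lambda>c. c * m) C) [(4, [1, 2]), (4, [2, 3])])"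
proof -
  have "pos_diffs (insert 0 (insert m {p, q})) = insert m {p, q, m - p, m - q, q - p}"
    using frame_2[OF assms(1-3)] by (simp add: insert_commute)
  moreover have "m \<notin> {p, q, m - p, m - q, q - p}" using assms(1-3) by simp
  ultimately have "int (card {p, q, m - p, m - q, q - p}) = 3"
    using assms(4) by (simp del: insert_iff)
  then show ?thesis
    using assms(1-3)

    by (simp only: int_card_insert finite_insert finite.emptyI simp_thms card.empty of_nat_0 if_False add_0_right insert_iff empty_iff list_ex_Nil_iff list_ex_Cons_iff prod.case list.map list.inject)
      (smt (z3))
qed

text \<open>Apart from \<open>m\<close> there are nine differences, which must take six values. The
  possible patterns of coincidence are systems of linear equations; their solutions in the given
  order are lines or isolated shapes up to dilation.\<close>

lemma five_element_frame_7:
  fixes m :: int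
  assumes "0 < p" "p < q" "q < r" "r < m"
    and "card (pos_diffs (insert 0 (insert m {p, q, r}))) = 7"
  shows "q = 2 * p \<and> r = 3 * p \<or> r = 2 * q \<and> 3 * q = m + p
    \<or> q + r = m + p \<and> 2 * r = m + q \<or> 2 * q = m + p \<and> r = p + q
    \<or> 2 * p = m \<and> 2 * (q + r) = 3 * m \<or> 2 * r = m \<and> 2 * (p + q) = m
    \<or> p + r = m \<and> (2 * q = m + p \<or> 2 * q = m - p \<or> 3 * p = m)
    \<or> p + q = m \<and> (3 * p = m \<or> 2 * r = m + q \<or> 2 * r = m + p \<or> 2 * q = p + r)
    \<or> q + r = m \<and> (3 * r = 2 * m \<or> 2 * p = q \<or> 2 * p = r \<or> 2 * q = p + r)
    \<or> (list_ex (\<lambda>(k, C). map ((*) k) [p, q, r] = map (\<lambda>c. c * m) C) sporadic_5)"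
proof -
  have "pos_diffs (insert 0 (insert m {p, q, r})) =
      insert m {p, q, r, m - p, m - q, m - r, q - p, r - p, r - q}"
    using frame_3[OF assms(1-4)] by (simp add: insert_commute)
  moreover have "m \<notin> {p, q, r, m - p, m - q, m - r, q - p, r - p, r - q}"
    using assms(1-4) by simp
  ultimately have six: "int (card {p, q, r, m - p, m - q, m - r, q - p, r - p, r - q}) = 6"
    using assms(5) by (simp del: insert_iff)
  \<comment> \<open>The order of the points rules out 16 of the 36 possible coincidences among the
    nine expressions; the other 20 appear in the sum of indicators.\<close>
  have ne: "p \<noteq> q" "p \<noteq> r" "q \<noteq> r" "q \<noteq> q - p" "r \<noteq> q - p" "r \<noteq> r - p" "r \<noteq> r - q"
      "m - p \<noteq> m - q" "m - p \<noteq> m - r" "m - p \<noteq> q - p" "m - p \<noteq> r - p" "m - p \<noteq> r - q"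
      "m - q \<noteq> m - r" "m - q \<noteq> r - q" "q - p \<noteq> r - p" "r - p \<noteq> r - q"
    using assms(1-4) by linarith+
  \<comment> \<open>\<open>linarith\<close> would split all the conditionals\<close>
  have shift: "a + (b + (c + (1 + (d + (e + (f + (1 + 1))))))) = 6 \<Longrightarrow>
      a + (b + (c + (d + (e + f)))) = 3" for a b c d e f :: int
    by linarith
  \<comment> \<open>A summand is 1 if its value does not recur later in the list. The values
    \<open>m - p\<close>, \<open>r - p\<close> and \<open>r - q\<close> never recur, so their three
    units have been cancelled from 6.\<close>
  have
    "(if p = m - p \<or> p = m - q \<or> p = m - r \<or> p = q - p \<or> p = r - p \<or> p = r - q then 0 else 1)
    + ((if q = m - p \<or> q = m - q \<or> q = m - r \<or> q = r - p \<or> q = r - q then 0 else 1)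
    + ((if r = m - p \<or> r = m - q \<or> r = m - r then 0 else 1)
    + ((if m - q = q - p \<or> m - q = r - p then 0 else 1)
    + ((if m - r = q - p \<or> m - r = r - p \<or> m - r = r - q then 0 else 1)
    + (if q - p = r - q then 0 else 1))))) = (3 :: int)"
    using six ne by (intro shift) (simp only: int_card_insert finite_insert finite.emptyI simp_thms card.empty
        of_nat_0 if_False add_0_right insert_iff empty_iff)
  then show ?thesis
    using assms(1-4) unfolding sporadic_5_def list_ex_Nil_iff list_ex_Cons_iff prod.case
      list.map list.inject simp_thms
    by (smt (z3))
qed

text \<open>The points \<open>p\<close>, \<open>q\<close>, \<open>r\<close>, \<open>s\<close> and
  \<open>m\<close> are differences from 0, which leaves only \<open>e\<close> and \<open>f\<close>
  free. Each of the ten differences not involving 0 must lie in this short list, and the resulting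
  linear systems leave symmetric one-parameter families and isolated shapes.\<close>

lemma six_element_frame_7:
  fixes m :: int
  assumes "0 < p" "p < q" "q < r" "r < s" "s < m"
    and D: "pos_diffs (insert 0 (insert m {p, q, r, s})) = {p, q, r, s, m, e, f}"
  shows "p + s = m \<and> q + r = m \<and> (q = 2 * p \<or> 2 * q + p = m \<or> 2 * p + q = m)
    \<or> (list_ex (\<lambda>(k, C). map ((*) k) [p, q, r, s] = map (\<lambda>c. c * m) C) sporadic_6)"
proof -
  have mem: "x - y \<in> {p, q, r, s, m, e, f}"
    if "x \<in> insert 0 (insert m {p, q, r, s})" "y \<in> insert 0 (insert m {p, q, r, s})" "y < x" for x y
    using that unfolding D[symmetric] pos_diffs_def by blast
  have "m - p \<in> {p, q, r, s, m, e, f}" "m - q \<in> {p, q, r, s, m, e, f}"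
      "m - r \<in> {p, q, r, s, m, e, f}" "m - s \<in> {p, q, r, s, m, e, f}"
      "q - p \<in> {p, q, r, s, m, e, f}" "r - p \<in> {p, q, r, s, m, e, f}"
      "s - p \<in> {p, q, r, s, m, e, f}" "r - q \<in> {p, q, r, s, m, e, f}"
      "s - q \<in> {p, q, r, s, m, e, f}" "s - r \<in> {p, q, r, s, m, e, f}"
    by (rule mem; use assms(1-5) in simp)+
  then show ?thesis
    using assms(1-5) unfolding sporadic_6_def
    by (simp only: insert_iff empty_iff simp_thms list_ex_Nil_iff list_ex_Cons_iff prod.case list.map list.inject)
      (smt (z3))
qed

text \<open>Now only one difference \<open>e\<close> is free, and no one-parameter family
  survives.\<close>

lemma seven_element_frame_7:
  fixes m :: int
  assumes "0 < p" "p < q" "q < r" "r < s" "s < t" "t < m"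
    and D: "pos_diffs (insert 0 (insert m {p, q, r, s, t})) = {p, q, r, s, t, m, e}"
  shows "list_ex (\<lambda>(k, C). map ((*) k) [p, q, r, s, t] = map (\<lambda>c. c * m) C) sporadic_7"
proof -
  have mem: "x - y \<in> {p, q, r, s, t, m, e}"
    if "x \<in> insert 0 (insert m {p, q, r, s, t})" "y \<in> insert 0 (insert m {p, q, r, s, t})" "y < x"
    for x y
    using that unfolding D[symmetric] pos_diffs_def by blast
  have "m - p \<in> {p, q, r, s, t, m, e}" "m - q \<in> {p, q, r, s, t, m, e}"
      "m - r \<in> {p, q, r, s, t, m, e}" "m - s \<in> {p, q, r, s, t, m, e}"
      "m - t \<in> {p, q, r, s, t, m, e}"
      "q - p \<in> {p, q, r, s, t, m, e}" "r - p \<in> {p, q, r, s, t, m, e}"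
      "s - p \<in> {p, q, r, s, t, m, e}" "t - p \<in> {p, q, r, s, t, m, e}"
      "r - q \<in> {p, q, r, s, t, m, e}" "s - q \<in> {p, q, r, s, t, m, e}"
      "t - q \<in> {p, q, r, s, t, m, e}" "s - r \<in> {p, q, r, s, t, m, e}"
      "t - r \<in> {p, q, r, s, t, m, e}" "t - s \<in> {p, q, r, s, t, m, e}"
    by (rule mem; use assms(1-6) in simp)+
  then show ?thesis
    using assms(1-6) unfolding sporadic_7_def
    by (simp only: insert_iff empty_iff simp_thms list_ex_Nil_iff list_ex_Cons_iff prod.case list.map list.inject)
      (smt (z3))
qed

text \<open>No difference is free. The values \<open>q - p < r - p < m - p\<close> lie below
  \<open>m\<close>, so they are \<open>p\<close>, \<open>q\<close>, \<open>r\<close> in this order,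
  which makes the frame an arithmetic progression.\<close>

lemma arithmetic_frame_4:
  fixes m :: int
  assumes "0 < p" "p < q" "q < r" "r < m"
    and D: "pos_diffs (insert 0 (insert m {p, q, r})) = {p, q, r, m}"
  shows "map ((*) 4) [p, q, r] = map (\<lambda>c. c * m) [1, 2, 3]"
proof -
  have mem: "x - y \<in> {p, q, r, m}"
    if "x \<in> insert 0 (insert m {p, q, r})" "y \<in> insert 0 (insert m {p, q, r})" "y < x" for x y
    using that unfolding D[symmetric] pos_diffs_def by blast
  have "q - p \<in> {p, q, r, m}" "r - p \<in> {p, q, r, m}" "m - p \<in> {p, q, r, m}"
    by (rule mem; use assms(1-4) in simp)+
  then show ?thesis using assms(1-4) by auto
qed

lemma arithmetic_frame_7:
  fixes m :: int
  assumes "0 < p" "p < q" "q < r" "r < s" "s < t" "t < u" "u < m"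
    and D: "pos_diffs (insert 0 (insert m {p, q, r, s, t, u})) = {p, q, r, s, t, u, m}"
  shows "map ((*) 7) [p, q, r, s, t, u] = map (\<lambda>c. c * m) [1, 2, 3, 4, 5, 6]"
proof -
  have mem: "x - y \<in> {p, q, r, s, t, u, m}"
    if "x \<in> insert 0 (insert m {p, q, r, s, t, u})" "y \<in> insert 0 (insert m {p, q, r, s, t, u})"
      "y < x" for x y
    using that unfolding D[symmetric] pos_diffs_def by blast
  have "q - p \<in> {p, q, r, s, t, u, m}" "r - p \<in> {p, q, r, s, t, u, m}"
      "s - p \<in> {p, q, r, s, t, u, m}" "t - p \<in> {p, q, r, s, t, u, m}"
      "u - p \<in> {p, q, r, s, t, u, m}" "m - p \<in> {p, q, r, s, t, u, m}"
    by (rule mem; use assms(1-7) in simp)+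
  then show ?thesis
    using assms(1-7) unfolding insert_iff empty_iff list.map list.inject by (smt (z3))
qed

section \<open>Upper bounds for the numbers of frames with four and seven positive
  differences\<close>

lemma sorted_enumeration:
  fixes A :: "int set"
  assumes "finite A"
  obtains xs where "sorted_wrt (<) xs" "set xs = A" "length xs = card A"
  using assms by (metis sorted_list_of_set.length_sorted_key_list_of_set
      sorted_list_of_set.set_sorted_key_list_of_set strict_sorted_list_of_set)

text \<open>Every point of the frame other than 0 is its own difference from 0. This limits the
  number of interior points to be considered.\<close>

lemma card_less_frame:
  assumes "A \<subseteq> {0<..<m}" "0 < m"
  shows "card A < card (pos_diffs (insert 0 (insert m A)))"
proof -
  have fin: "finite A" using assms(1) finite_subset by blast
  have "m \<notin> A" using assms(1) by auto
  then have "Suc (card A) = card (insert m A)" using fin by simp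
  also have "\<dots> \<le> card (pos_diffs (insert 0 (insert m A)))"
    using fin pos_diffs_frame[OF assms] by (intro card_mono) auto
  finally show ?thesis by simp
qed

lemma triple_imageI:
  "p = a t \<Longrightarrow> q = b t \<Longrightarrow> r = c t \<Longrightarrow> t \<in> T \<Longrightarrow> {p, q, r} \<in> (\<lambda>t. {a t, b t, c t}) ` T"
  by blast

text \<open>At most one interior point gives at most three differences. Two points give the
  symmetric line, with at most \<open>m / 2 + 1\<close> members, or one of two dilates; three points
  give a progression. Doubling \<open>m / 2 + 1 + 3\<close> yields the bound.\<close>

lemma card_framed_4_le:
  assumes "0 < m"
  shows "2 * int (card (framed 4 m)) \<le> m + 8"
proof -
  let ?L = "(\<lambda>t. {t, m - t}) ` {t. 0 < t \<and> 2 * t < m}"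
  let ?C = "[(4, [1, 2]), (4, [2, 3]), (4, [1, 2, 3])] :: (int \<times> int list) list"
  have L: "finite ?L \<and> 2 * int (card ?L) \<le> m + 2"
    by (rule card_image_spread; use assms in simp)+
  have "framed 4 m \<subseteq> ?L \<union> dilate m ` set ?C"
  proof
    fix A assume "A \<in> framed 4 m"
    then have A: "A \<subseteq> {0<..<m}" and D: "card (pos_diffs (insert 0 (insert m A))) = 4"
      by (auto simp: framed_def)
    have fin: "finite A" using A finite_subset by blast
    obtain xs where xs: "sorted_wrt (<) xs" "set xs = A" "length xs = card A"
      using sorted_enumeration[OF fin] .
    have "length xs < 4" using card_less_frame[OF A assms] D xs(3) by simp
    then consider "xs = []" | p where "xs = [p]" | p q where "xs = [p, q]"
      | p q r where "xs = [p, q, r]"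
      by (auto simp: numeral_eq_Suc less_Suc_eq length_Suc_conv)
    then show "A \<in> ?L \<union> dilate m ` set ?C"
    proof cases
      case 1
      then have "A = {}" using xs by simp
      then show ?thesis using D frame_0[OF assms] by simp
    next
      case 2
      then have "A = {p}" "0 < p" "p < m" using xs A by auto
      then have "card {p, m - p, m} = 4" using D frame_1 by simp
      moreover have "card {p, m - p, m} \<le> 3" using card_length[of "[p, m - p, m]"] by simp
      ultimately show ?thesis by simp
    next
      case 3
      then have pq: "A = {p, q}" "0 < p" "p < q" "q < m" using xs A by auto
      have "p + q = m \<or> list_ex (\<lambda>(k, C). map ((*) k) [p, q] = map (\<lambda>c. c * m) C)
          [(4, [1, 2]), (4, [2, 3])]"
        using four_element_frame_4[OF pq(2-4)] D pq(1) by simp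
      then show ?thesis
      proof
        assume "p + q = m"
        then have "A \<in> ?L" using pq by (intro image_eqI[of _ _ p]) auto
        then show ?thesis by blast
      next
        assume "list_ex (\<lambda>(k, C). map ((*) k) [p, q] = map (\<lambda>c. c * m) C)
          [(4, [1, 2]), (4, [2, 3])]"
        from bex_dilateI[OF this] show ?thesis using pq(1) by auto
      qed
    next
      case 4
      then have pq: "A = {p, q, r}" "0 < p" "p < q" "q < r" "r < m" using xs A by auto
      have "{p, q, r, m} \<subseteq> pos_diffs (insert 0 (insert m {p, q, r}))"
        using frame_3[OF pq(2-5)] by auto
      moreover have "card {p, q, r, m} = 4" using pq by simp
      ultimately have "pos_diffs (insert 0 (insert m {p, q, r})) = {p, q, r, m}"
        using D fin pq(1) by (metis card_subset_eq finite_frame)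
      from dilateI[OF arithmetic_frame_4[OF pq(2-5) this]] show ?thesis using pq(1) by auto
    qed
  qed
  then have "card (framed 4 m) \<le> card (?L \<union> dilate m ` set ?C)"
    using L by (intro card_mono) auto
  also have "\<dots> \<le> card ?L + length ?C"
    by (intro card_Un_mono order_refl card_dilates)
  finally show ?thesis using L by simp
qed

text \<open>The parameter intervals of the 14 lines have total length
  \<open>6 * m / 3 + 5 * m / 6 + 2 * m / 4 + m = 13 * m / 3\<close>. Each line costs one further
  unit, and there are \<open>8 + 23 + 8 + 1 = 40\<close> dilates, so the constant is
  \<open>3 * 54 = 162\<close>.\<close>

lemma card_framed_7_le:
  assumes "0 < m"
  shows "3 * int (card (framed 7 m)) \<le> 13 * m + 162"
proof -
  \<comment> \<open>five-element frames are covered by the lines \<open>?A1\<close> to \<open>?A12\<close>, six-element ones by \<open>?B1\<close> and \<open>?B2\<close>\<close>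
  let ?A1 = "(\<lambda>t. {t, 2 * t, 3 * t}) ` {t. 0 < t \<and> 3 * t < m}"
  let ?A2 = "(\<lambda>t. {3 * t - m, t, 2 * t}) ` {t. m < 3 * t \<and> 2 * t < m}"
  let ?A3 = "(\<lambda>t. {3 * t - 2 * m, 2 * t - m, t}) ` {t. 2 * m < 3 * t \<and> t < m}"
  let ?A4 = "(\<lambda>t. {2 * t - m, t, 3 * t - m}) ` {t. m < 2 * t \<and> 3 * t < 2 * m}"
  let ?A5 = "(\<lambda>t. {m div 2, t, 3 * (m div 2) - t}) ` {t. m < 2 * t \<and> 4 * t < 3 * m}"
  let ?A6 = "(\<lambda>t. {t, m div 2 - t, m div 2}) ` {t. 0 < t \<and> 4 * t < m}"
  let ?A7 = "(\<lambda>t. {2 * t - m, t, 2 * m - 2 * t}) ` {t. m < 2 * t \<and> 3 * t < 2 * m}"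
  let ?A8 = "(\<lambda>t. {m - 2 * t, t, 2 * t}) ` {t. m < 3 * t \<and> 2 * t < m}"
  let ?A9 = "(\<lambda>t. {m div 3, m - m div 3, t}) ` {t. 0 < t \<and> t < m}"
  let ?A10 = "(\<lambda>t. {2 * m - 2 * t, 2 * t - m, t}) ` {t. 2 * m < 3 * t \<and> t < m}"
  let ?A11 = "(\<lambda>t. {m - t, t, 3 * t - m}) ` {t. m < 3 * t \<and> 3 * t < 2 * m}"
  let ?A12 = "(\<lambda>t. {t, 2 * t, m - 2 * t}) ` {t. 0 < t \<and> 3 * t < m}"
  let ?B1 = "(\<lambda>t. {t, 2 * t, m - 2 * t, m - t}) ` {t. 0 < t \<and> 3 * t < m}"
  let ?B2 = "(\<lambda>t. {m - 2 * t, t, m - t, 2 * t}) ` {t. m < 3 * t \<and> 2 * t < m}"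
  let ?C1 = "dilate m ` set sporadic_5"
  let ?C2 = "dilate m ` set sporadic_6"
  let ?C3 = "dilate m ` set sporadic_7"
  let ?C4 = "dilate m ` set [(7, [1, 2, 3, 4, 5, 6])]"
  let ?U = "?A1 \<union> ?A2 \<union> ?A3 \<union> ?A4 \<union> ?A5 \<union> ?A6 \<union> ?A7 \<union> ?A8 \<union> ?A9 \<union> ?A10 \<union> ?A11 \<union> ?A12
    \<union> ?B1 \<union> ?B2 \<union> ?C1 \<union> ?C2 \<union> ?C3 \<union> ?C4"
  \<comment> \<open>The lines are grouped by the length of the parameter interval:
    \<open>m / 3\<close>, then \<open>m / 6\<close>, then \<open>m / 4\<close> or
    \<open>m\<close>.\<close>
  have thirds: "finite ?A1 \<and> 3 * int (card ?A1) \<le> m + 3" "finite ?A3 \<and> 3 * int (card ?A3) \<le> m + 3"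
    "finite ?A10 \<and> 3 * int (card ?A10) \<le> m + 3" "finite ?A11 \<and> 3 * int (card ?A11) \<le> m + 3"
    "finite ?A12 \<and> 3 * int (card ?A12) \<le> m + 3" "finite ?B1 \<and> 3 * int (card ?B1) \<le> m + 3"
    by (rule card_image_spread; use assms in simp)+
  have sixths: "finite ?A2 \<and> 6 * int (card ?A2) \<le> m + 6" "finite ?A4 \<and> 6 * int (card ?A4) \<le> m + 6"
    "finite ?A7 \<and> 6 * int (card ?A7) \<le> m + 6" "finite ?A8 \<and> 6 * int (card ?A8) \<le> m + 6"
    "finite ?B2 \<and> 6 * int (card ?B2) \<le> m + 6"
    by (rule card_image_spread; use assms in simp)+
  have others: "finite ?A5 \<and> 4 * int (card ?A5) \<le> m + 4" "finite ?A6 \<and> 4 * int (card ?A6) \<le> m + 4"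
    "finite ?A9 \<and> 1 * int (card ?A9) \<le> m + 1"
    by (rule card_image_spread; use assms in simp)+
  have five: "{p, q, r} \<in> ?U"
    if ord: "0 < p" "p < q" "q < r" "r < m"
      and D: "card (pos_diffs (insert 0 (insert m {p, q, r}))) = 7" for p q r
  proof -
    \<comment> \<open>Some alternatives of the classification differ only in the order of the
      points, so \<open>?A9\<close> to \<open>?A12\<close> each serve several of them after a
      permutation.\<close>
    have swap: "{p, q, r} = {q, p, r}" "{p, q, r} = {q, r, p}" "{p, q, r} = {p, r, q}"
      "{p, q, r} = {r, q, p}" by auto
    from five_element_frame_7[OF ord D, unfolded conj_disj_distribL] show ?thesis
    proof (elim disjE)
      assume "q = 2 * p \<and> r = 3 * p"
      then have c: "q = 2 * p" "r = 3 * p" by simp_all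
      have "{p, q, r} \<in> ?A1"
        by (rule triple_imageI[where t = p]; (unfold mem_Collect_eq)?; (intro conjI)?;
            use ord c in \<open>linarith | simp\<close>)
      then show ?thesis by (simp only: Un_iff simp_thms)
    next
      assume "r = 2 * q \<and> 3 * q = m + p"
      then have c: "r = 2 * q" "3 * q = m + p" by simp_all
      have "{p, q, r} \<in> ?A2"
        by (rule triple_imageI[where t = q]; (unfold mem_Collect_eq)?; (intro conjI)?;
            use ord c in \<open>linarith | simp\<close>)
      then show ?thesis by (simp only: Un_iff simp_thms)
    next
      assume "q + r = m + p \<and> 2 * r = m + q"
      then have c: "q + r = m + p" "2 * r = m + q" by simp_all
      have "{p, q, r} \<in> ?A3"
        by (rule triple_imageI[where t = r]; (unfold mem_Collect_eq)?; (intro conjI)?;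
            use ord c in \<open>linarith | simp\<close>)
      then show ?thesis by (simp only: Un_iff simp_thms)
    next
      assume "2 * q = m + p \<and> r = p + q"
      then have c: "2 * q = m + p" "r = p + q" by simp_all
      have "{p, q, r} \<in> ?A4"
        by (rule triple_imageI[where t = q]; (unfold mem_Collect_eq)?; (intro conjI)?;
            use ord c in \<open>linarith | simp\<close>)
      then show ?thesis by (simp only: Un_iff simp_thms)
    next
      assume "2 * p = m \<and> 2 * (q + r) = 3 * m"
      then have c: "2 * p = m" "2 * (q + r) = 3 * m" by simp_all
      then have half: "m div 2 = p" by presburger
      have "{p, q, r} \<in> ?A5"
        by (rule triple_imageI[where t = q]; (unfold mem_Collect_eq)?; (intro conjI)?;
            (unfold half)?; use ord c in \<open>linarith | simp\<close>)
      then show ?thesis by (simp only: Un_iff simp_thms)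
    next
      assume "2 * r = m \<and> 2 * (p + q) = m"
      then have c: "2 * r = m" "2 * (p + q) = m" by simp_all
      then have half: "m div 2 = r" by presburger
      have "{p, q, r} \<in> ?A6"
        by (rule triple_imageI[where t = p]; (unfold mem_Collect_eq)?; (intro conjI)?;
            (unfold half)?; use ord c in \<open>linarith | simp\<close>)
      then show ?thesis by (simp only: Un_iff simp_thms)
    next
      assume "p + r = m \<and> 2 * q = m + p"
      then have c: "p + r = m" "2 * q = m + p" by simp_all
      have "{p, q, r} \<in> ?A7"
        by (rule triple_imageI[where t = q]; (unfold mem_Collect_eq)?; (intro conjI)?;
            use ord c in \<open>linarith | simp\<close>)
      then show ?thesis by (simp only: Un_iff simp_thms)
    next
      assume "p + r = m \<and> 2 * q = m - p"
      then have c: "p + r = m" "2 * q = m - p" by simp_all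
      have "{p, q, r} \<in> ?A8"
        by (rule triple_imageI[where t = q]; (unfold mem_Collect_eq)?; (intro conjI)?;
            use ord c in \<open>linarith | simp\<close>)
      then show ?thesis by (simp only: Un_iff simp_thms)
    next
      assume "p + r = m \<and> 3 * p = m"
      then have c: "p + r = m" "3 * p = m" by simp_all
      then have third: "m div 3 = p" by presburger
      have "{p, r, q} \<in> ?A9"
        by (rule triple_imageI[where t = q]; (unfold mem_Collect_eq)?; (intro conjI)?;
            (unfold third)?; use ord c in \<open>linarith | simp\<close>)
      then show ?thesis unfolding swap(3) by (simp only: Un_iff simp_thms)
    next
      assume "p + q = m \<and> 3 * p = m"
      then have c: "p + q = m" "3 * p = m" by simp_all
      then have third: "m div 3 = p" by presburger
      have "{p, q, r} \<in> ?A9"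
        by (rule triple_imageI[where t = r]; (unfold mem_Collect_eq)?; (intro conjI)?;
            (unfold third)?; use ord c in \<open>linarith | simp\<close>)
      then show ?thesis by (simp only: Un_iff simp_thms)
    next
      assume "p + q = m \<and> 2 * r = m + q"
      then have c: "p + q = m" "2 * r = m + q" by simp_all
      have "{p, q, r} \<in> ?A10"
        by (rule triple_imageI[where t = r]; (unfold mem_Collect_eq)?; (intro conjI)?;
            use ord c in \<open>linarith | simp\<close>)
      then show ?thesis by (simp only: Un_iff simp_thms)
    next
      assume "p + q = m \<and> 2 * r = m + p"
      then have c: "p + q = m" "2 * r = m + p" by simp_all
      have "{q, p, r} \<in> ?A10"
        by (rule triple_imageI[where t = r]; (unfold mem_Collect_eq)?; (intro conjI)?;
            use ord c in \<open>linarith | simp\<close>)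
      then show ?thesis unfolding swap(1) by (simp only: Un_iff simp_thms)
    next
      assume "p + q = m \<and> 2 * q = p + r"
      then have c: "p + q = m" "2 * q = p + r" by simp_all
      have "{p, q, r} \<in> ?A11"
        by (rule triple_imageI[where t = q]; (unfold mem_Collect_eq)?; (intro conjI)?;
            use ord c in \<open>linarith | simp\<close>)
      then show ?thesis by (simp only: Un_iff simp_thms)
    next
      assume "q + r = m \<and> 3 * r = 2 * m"
      then have c: "q + r = m" "3 * r = 2 * m" by simp_all
      then have third: "m div 3 = q" by presburger
      have "{q, r, p} \<in> ?A9"
        by (rule triple_imageI[where t = p]; (unfold mem_Collect_eq)?; (intro conjI)?;
            (unfold third)?; use ord c in \<open>linarith | simp\<close>)
      then show ?thesis unfolding swap(2) by (simp only: Un_iff simp_thms)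
    next
      assume "q + r = m \<and> 2 * p = q"
      then have c: "q + r = m" "2 * p = q" by simp_all
      have "{p, q, r} \<in> ?A12"
        by (rule triple_imageI[where t = p]; (unfold mem_Collect_eq)?; (intro conjI)?;
            use ord c in \<open>linarith | simp\<close>)
      then show ?thesis by (simp only: Un_iff simp_thms)
    next
      assume "q + r = m \<and> 2 * p = r"
      then have c: "q + r = m" "2 * p = r" by simp_all
      have "{p, r, q} \<in> ?A12"
        by (rule triple_imageI[where t = p]; (unfold mem_Collect_eq)?; (intro conjI)?;
            use ord c in \<open>linarith | simp\<close>)
      then show ?thesis unfolding swap(3) by (simp only: Un_iff simp_thms)
    next
      assume "q + r = m \<and> 2 * q = p + r"
      then have c: "q + r = m" "2 * q = p + r" by simp_all
      have "{r, q, p} \<in> ?A11"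
        by (rule triple_imageI[where t = q]; (unfold mem_Collect_eq)?; (intro conjI)?;
            use ord c in \<open>linarith | simp\<close>)
      then show ?thesis unfolding swap(4) by (simp only: Un_iff simp_thms)
    next
      assume c: "list_ex (\<lambda>(k, C). map ((*) k) [p, q, r] = map (\<lambda>c. c * m) C) sporadic_5"
      from bex_dilateI[OF c] have "{p, q, r} \<in> ?C1" by (simp add: sporadic_5_def)
      then show ?thesis by (simp only: Un_iff simp_thms)
    qed
  qed
  have six: "{p, q, r, s} \<in> ?U"
    if ord: "0 < p" "p < q" "q < r" "r < s" "s < m"
      and D: "card (pos_diffs (insert 0 (insert m {p, q, r, s}))) = 7" for p q r s
  proof -
    let ?D = "pos_diffs (insert 0 (insert m {p, q, r, s}))"
    have sub: "{p, q, r, s, m} \<subseteq> ?D" using ord by (subst pos_diffs_frame) auto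
    have "card {p, q, r, s, m} = 5" using ord by simp
    then have "card (?D - {p, q, r, s, m}) = 2"
      using sub D by (subst card_Diff_subset) auto
    then obtain e f where "?D - {p, q, r, s, m} = {e, f}" by (meson card_2_iff)
    then have "?D = {p, q, r, s, m, e, f}" using sub by blast
    from six_element_frame_7[OF ord this, unfolded conj_disj_distribL] show ?thesis
    proof (elim disjE)
      assume "p + s = m \<and> q + r = m \<and> q = 2 * p"
      then have "{p, q, r, s} \<in> ?B1" using ord by (intro image_eqI[of _ _ p]) auto
      then show ?thesis by (simp only: Un_iff simp_thms)
    next
      assume "p + s = m \<and> q + r = m \<and> 2 * q + p = m"
      then have "p = m - 2 * q" "r = m - q" "s = 2 * q" by auto
      then have "{p, q, r, s} \<in> ?B2" using ord by (intro image_eqI[of _ _ q]) auto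
      then show ?thesis by (simp only: Un_iff simp_thms)
    next
      assume "p + s = m \<and> q + r = m \<and> 2 * p + q = m"
      then have "q = m - 2 * p" "r = 2 * p" "s = m - p" by auto
      then have "{p, q, r, s} \<in> ?B1" using ord by (intro image_eqI[of _ _ p]) auto
      then show ?thesis by (simp only: Un_iff simp_thms)
    next
      assume "list_ex (\<lambda>(k, C). map ((*) k) [p, q, r, s] = map (\<lambda>c. c * m) C) sporadic_6"
      from bex_dilateI[OF this] have "{p, q, r, s} \<in> ?C2" by (simp add: sporadic_6_def)
      then show ?thesis by (simp only: Un_iff simp_thms)
    qed
  qed
  have seven: "{p, q, r, s, t} \<in> ?U"
    if ord: "0 < p" "p < q" "q < r" "r < s" "s < t" "t < m"
      and D: "card (pos_diffs (insert 0 (insert m {p, q, r, s, t}))) = 7" for p q r s t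
  proof -
    let ?D = "pos_diffs (insert 0 (insert m {p, q, r, s, t}))"
    have sub: "{p, q, r, s, t, m} \<subseteq> ?D" using ord by (subst pos_diffs_frame) auto
    have "card {p, q, r, s, t, m} = 6" using ord by simp
    then have "card (?D - {p, q, r, s, t, m}) = 1"
      using sub D by (subst card_Diff_subset) auto
    then obtain e where "?D - {p, q, r, s, t, m} = {e}" by (meson card_1_singletonE)
    then have "?D = {p, q, r, s, t, m, e}" using sub by blast
    from bex_dilateI[OF seven_element_frame_7[OF ord this]]
    have "{p, q, r, s, t} \<in> ?C3" by (simp add: sporadic_7_def)
    then show ?thesis by (simp only: Un_iff simp_thms)
  qed
  have eight: "{p, q, r, s, t, u} \<in> ?U"
    if ord: "0 < p" "p < q" "q < r" "r < s" "s < t" "t < u" "u < m"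
      and D: "card (pos_diffs (insert 0 (insert m {p, q, r, s, t, u}))) = 7" for p q r s t u
  proof -
    let ?D = "pos_diffs (insert 0 (insert m {p, q, r, s, t, u}))"
    have sub: "{p, q, r, s, t, u, m} \<subseteq> ?D" using ord by (subst pos_diffs_frame) auto
    have "card {p, q, r, s, t, u, m} = 7" using ord by simp
    then have "?D = {p, q, r, s, t, u, m}"
      using card_subset_eq[OF _ sub] D finite_frame[of "{p, q, r, s, t, u}" m] by simp
    from dilateI[OF arithmetic_frame_7[OF ord this]]
    have "{p, q, r, s, t, u} \<in> ?C4" by simp
    then show ?thesis by (simp only: Un_iff simp_thms)
  qed
  have "framed 7 m \<subseteq> ?U"
  proof
    fix A assume "A \<in> framed 7 m"
    then have A: "A \<subseteq> {0<..<m}" and D: "card (pos_diffs (insert 0 (insert m A))) = 7"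
      by (auto simp: framed_def)
    have fin: "finite A" using A finite_subset by blast
    obtain xs where xs: "sorted_wrt (<) xs" "set xs = A" "length xs = card A"
      using sorted_enumeration[OF fin] .
    have "length xs < 7" using card_less_frame[OF A assms] D xs(3) by simp
    then consider "xs = []" | p where "xs = [p]" | p q where "xs = [p, q]"
      | p q r where "xs = [p, q, r]" | p q r s where "xs = [p, q, r, s]"
      | p q r s t where "xs = [p, q, r, s, t]" | p q r s t u where "xs = [p, q, r, s, t, u]"
      by (auto simp: numeral_eq_Suc less_Suc_eq length_Suc_conv)
    then show "A \<in> ?U"
    proof cases
      case 1
      then have "A = {}" using xs by simp
      then show ?thesis using D frame_0[OF assms] by simp
    next
      case 2
      then have "A = {p}" "0 < p" "p < m" using xs A by auto
      then have "card {p, m - p, m} = 7" using D frame_1 by simp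
      moreover have "card {p, m - p, m} \<le> 3" using card_length[of "[p, m - p, m]"] by simp
      ultimately show ?thesis by simp
    next
      case 3
      then have pq: "A = {p, q}" "0 < p" "p < q" "q < m" using xs A by auto
      then have "card {p, q, m - p, m - q, q - p, m} = 7" using D frame_2 by simp
      moreover have "card {p, q, m - p, m - q, q - p, m} \<le> 6"
        using card_length[of "[p, q, m - p, m - q, q - p, m]"] by simp
      ultimately show ?thesis by simp
    next
      case 4
      then have pq: "A = {p, q, r}" "0 < p" "p < q" "q < r" "r < m" using xs A by auto
      show ?thesis using five[OF pq(2-5)] D unfolding pq(1) by (simp only:)
    next
      case 5
      then have pq: "A = {p, q, r, s}" "0 < p" "p < q" "q < r" "r < s" "s < m" using xs A by auto
      show ?thesis using six[OF pq(2-6)] D unfolding pq(1) by (simp only:)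
    next
      case 6
      then have pq: "A = {p, q, r, s, t}" "0 < p" "p < q" "q < r" "r < s" "s < t" "t < m"
        using xs A by auto
      show ?thesis using seven[OF pq(2-7)] D unfolding pq(1) by (simp only:)
    next
      case 7
      then have Aeq: "A = {p, q, r, s, t, u}" using xs(2) by simp
      have pq: "0 < p" "p < q" "q < r" "r < s" "s < t" "t < u" "u < m"
        using A xs(1) 7 unfolding Aeq by simp_all
      show ?thesis using eight[OF pq] D unfolding Aeq by (simp only:)
    qed
  qed
  moreover have "finite ?U"
    by (intro finite_UnI; (rule finite_imageI[OF finite_set] | use thirds sixths others in blast))
  ultimately have "card (framed 7 m) \<le> card ?U" by (rule card_mono[rotated])
  also have "\<dots> \<le> card ?A1 + card ?A2 + card ?A3 + card ?A4 + card ?A5 + card ?A6 + card ?A7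
      + card ?A8 + card ?A9 + card ?A10 + card ?A11 + card ?A12 + card ?B1 + card ?B2
      + length sporadic_5 + length sporadic_6 + length sporadic_7
      + length [(7 :: int, [1, 2, 3, 4, 5, 6 :: int])]"
    by (intro card_Un_mono order_refl card_dilates)
  finally have "card (framed 7 m) \<le> card ?A1 + card ?A2 + card ?A3 + card ?A4 + card ?A5
      + card ?A6 + card ?A7 + card ?A8 + card ?A9 + card ?A10 + card ?A11 + card ?A12
      + card ?B1 + card ?B2 + 8 + 23 + 8 + 1"
    unfolding sporadic_5_def sporadic_6_def sporadic_7_def list.size by simp
  then show ?thesis
    using thirds[THEN conjunct2] sixths[THEN conjunct2] others[THEN conjunct2] by linarith
qed

section \<open>Lower bounds\<close>

lemma card_framed_1_ge:
  assumes "0 < m"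
  shows "1 \<le> card (framed 1 m)"
proof -
  have "{} \<in> framed 1 m" using frame_0[OF assms] by (simp add: framed_def)
  then have "card {{} :: int set} \<le> card (framed 1 m)"
    by (intro card_mono finite_framed) simp
  then show ?thesis by simp
qed

text \<open>Two differences allow exactly one interior point \<open>p\<close>, and \<open>p\<close>
  must coincide with \<open>m - p\<close>; hence the midpoint is the only candidate.\<close>

lemma card_framed_2_le:
  assumes "0 < m"
  shows "card (framed 2 m) \<le> 1"
proof -
  have "framed 2 m \<subseteq> {{m div 2}}"
  proof
    fix A assume "A \<in> framed 2 m"
    then have A: "A \<subseteq> {0<..<m}" and D: "card (pos_diffs (insert 0 (insert m A))) = 2"
      by (auto simp: framed_def)
    have "A \<noteq> {}" using D frame_0[OF assms] by auto
    moreover have "finite A" using A finite_subset by blast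
    ultimately have "card A \<noteq> 0" by simp
    then have "card A = 1" using card_less_frame[OF A assms] D by linarith
    then obtain p where p: "A = {p}" by (rule card_1_singletonE)
    then have "0 < p" "p < m" using A by auto
    then have "card {p, m - p, m} = 2" using D p frame_1 by simp
    then have "2 * p = m"
      using \<open>0 < p\<close> \<open>p < m\<close> by (auto simp: card_insert_if split: if_splits)
    then show "A \<in> {{m div 2}}" using p by auto
  qed
  then have "card (framed 2 m) \<le> card {{m div 2}}" by (intro card_mono) auto
  then show ?thesis by simp
qed

text \<open>Every single interior point other than the midpoint gives three differences.\<close>

lemma card_framed_3_ge:
  assumes "0 < m"
  shows "m - 2 \<le> int (card (framed 3 m))"
proof -
  let ?T = "{0<..<m} - {m div 2}"
  have "(\<lambda>t. {t}) ` ?T \<subseteq> framed 3 m"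
  proof
    fix A assume "A \<in> (\<lambda>t. {t}) ` ?T"
    then obtain p where "A = {p}" "p \<in> ?T" by blast
    then have p: "A = {p}" "0 < p" "p < m" "p \<noteq> m div 2" by simp_all
    then have "p \<noteq> m - p" by auto
    then have "card {p, m - p, m} = 3" using p by simp
    then show "A \<in> framed 3 m" using p frame_1 by (simp add: framed_def)
  qed
  then have "card ((\<lambda>t. {t}) ` ?T) \<le> card (framed 3 m)"
    by (intro card_mono finite_framed)
  moreover have "card ((\<lambda>t. {t}) ` ?T) = card ?T" by (intro card_image) (simp add: inj_on_def)
  moreover have "card {0<..<m} - card {m div 2} \<le> card ?T" by (rule diff_card_le_card_Diff) simp
  ultimately show ?thesis using assms by simp
qed

text \<open>The frame with points \<open>0, t, 2 * t, m\<close> repeats the difference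
  \<open>t\<close> and so has five differences in general; for \<open>t\<close> beyond the midpoint
  its mirror image is used. The five values removed from the \<open>m - 1\<close> candidates are the
  midpoint and those where a further coincidence occurs.\<close>

lemma card_framed_5_ge:
  assumes "0 < m"
  shows "m - 6 \<le> int (card (framed 5 m))"
proof -
  let ?T = "{0<..<m} - {m div 2, m div 3, m div 4, 2 * m div 3, 3 * m div 4}"
  let ?f = "\<lambda>t. if 2 * t < m then {t, 2 * t} else {2 * t - m, t}"
  have T: "0 < t \<and> t < m \<and> 2 * t \<noteq> m \<and> 3 * t \<noteq> m \<and> 4 * t \<noteq> m \<and> 3 * t \<noteq> 2 * m \<and> 4 * t \<noteq> 3 * m"
    if "t \<in> ?T" for t
  proof -
    have n: "0 < t" "t < m" "t \<noteq> m div 2" "t \<noteq> m div 3" "t \<noteq> m div 4"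
      "t \<noteq> 2 * m div 3" "t \<noteq> 3 * m div 4"
      using that by simp_all
    have "2 * t \<noteq> m" using n(3) by auto
    moreover have "3 * t \<noteq> m" using n(4) by auto
    moreover have "4 * t \<noteq> m" using n(5) by auto
    moreover have "3 * t \<noteq> 2 * m" using n(6) by presburger
    moreover have "4 * t \<noteq> 3 * m" using n(7) by presburger
    ultimately show ?thesis using n(1,2) by simp
  qed
  have "?f ` ?T \<subseteq> framed 5 m"
  proof
    fix A assume "A \<in> ?f ` ?T"
    then obtain t where t: "A = ?f t" "t \<in> ?T" by blast
    show "A \<in> framed 5 m"
    proof (cases "2 * t < m")
      case True
      then have "card {2 * t, m - t, m - 2 * t, t, m} = 5" using T[OF t(2)] by simp
      moreover have "{t, 2 * t, m - t, m - 2 * t, 2 * t - t, m} = {2 * t, m - t, m - 2 * t, t, m}"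
        by auto
      moreover have "pos_diffs (insert 0 (insert m {t, 2 * t})) =
          {t, 2 * t, m - t, m - 2 * t, 2 * t - t, m}"
        using True T[OF t(2)] by (intro frame_2) auto
      ultimately show ?thesis using True T[OF t(2)] t(1) by (simp add: framed_def)
    next
      case False
      then have "card {2 * t - m, t, m - (2 * t - m), m - t, m} = 5"
        using T[OF t(2)] by simp
      moreover have "{2 * t - m, t, m - (2 * t - m), m - t, t - (2 * t - m), m} =
          {2 * t - m, t, m - (2 * t - m), m - t, m}"
        by auto
      moreover have "pos_diffs (insert 0 (insert m {2 * t - m, t})) =
          {2 * t - m, t, m - (2 * t - m), m - t, t - (2 * t - m), m}"
        using False T[OF t(2)] by (intro frame_2) auto
      ultimately show ?thesis using False T[OF t(2)] t(1) by (simp add: framed_def)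
    qed
  qed
  then have "card (?f ` ?T) \<le> card (framed 5 m)"
    by (intro card_mono finite_framed)
  moreover have "inj_on ?f ?T"
  proof (rule inj_onI)
    fix s t assume st: "s \<in> ?T" "t \<in> ?T" and eq: "?f s = ?f t"
    consider "2 * s < m" "2 * t < m" | "2 * s < m" "\<not> 2 * t < m"
      | "\<not> 2 * s < m" "2 * t < m" | "\<not> 2 * s < m" "\<not> 2 * t < m" by blast
    then show "s = t"
      using T[OF st(1)] T[OF st(2)] eq by cases (simp_all add: doubleton_eq_iff, linarith+)
  qed
  then have "card (?f ` ?T) = card ?T" by (rule card_image)
  moreover have "card {0<..<m} - card {m div 2, m div 3, m div 4, 2 * m div 3, 3 * m div 4} \<le> card ?T"
    by (rule diff_card_le_card_Diff) simp
  moreover have "card {m div 2, m div 3, m div 4, 2 * m div 3, 3 * m div 4} \<le> 5"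
    using card_length[of "[m div 2, m div 3, m div 4, 2 * m div 3, 3 * m div 4]"] by simp
  moreover have "card {0<..<m} = nat (m - 1)" by simp
  ultimately have "nat (m - 1) \<le> card (framed 5 m) + 5" by linarith
  then show ?thesis by linarith
qed

text \<open>Two interior points give six distinct differences unless one of five linear relations
  holds. The exceptional pairs lie on three lines of at most \<open>m / 2 + 1\<close> members and
  one of at most \<open>m + 1\<close>, which after doubling gives \<open>5 * m + 8\<close>; the left
  side is twice the number of pairs.\<close>

lemma card_framed_6_ge:
  assumes "0 < m"
  shows "(m - 1) * (m - 2) \<le> 2 * int (card (framed 6 m)) + 5 * m + 8"
proof -
  let ?P = "{A. A \<subseteq> {0<..<m} \<and> card A = 2}"
  let ?L1 = "(\<lambda>t. {t, 2 * t}) ` {t. 0 < t \<and> 2 * t < m}"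
  let ?L2 = "(\<lambda>t. {t, m - t}) ` {t. 0 < t \<and> 2 * t < m}"
  let ?L3 = "(\<lambda>t. {2 * t - m, t}) ` {t. m < 2 * t \<and> t < m}"
  let ?L4 = "(\<lambda>t. {m div 2, t}) ` {t. 0 < t \<and> t < m}"
  have L: "finite ?L1 \<and> 2 * int (card ?L1) \<le> m + 2" "finite ?L2 \<and> 2 * int (card ?L2) \<le> m + 2"
    "finite ?L3 \<and> 2 * int (card ?L3) \<le> m + 2" "finite ?L4 \<and> 1 * int (card ?L4) \<le> m + 1"
    by (rule card_image_spread; use assms in simp)+
  have "?P \<subseteq> framed 6 m \<union> ?L1 \<union> ?L2 \<union> ?L3 \<union> ?L4"
  proof
    fix A assume "A \<in> ?P"
    then have A: "A \<subseteq> {0<..<m}" "card A = 2" by auto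
    then obtain x y where "A = {x, y}" "x \<noteq> y" by (meson card_2_iff)
    then obtain p q where pq: "A = {p, q}" "p < q" by (metis insert_commute linorder_neqE)
    then have ord: "0 < p" "p < q" "q < m" using A by auto
    show "A \<in> framed 6 m \<union> ?L1 \<union> ?L2 \<union> ?L3 \<union> ?L4"
    proof (cases "q = 2 * p \<or> p + q = m \<or> 2 * q = m + p \<or> 2 * p = m \<or> 2 * q = m")
      case True
      then show ?thesis
      proof (elim disjE)
        assume "q = 2 * p"
        then have "A \<in> ?L1" using pq ord by (intro image_eqI[of _ _ p]) auto
        then show ?thesis by blast
      next
        assume "p + q = m"
        then have "A \<in> ?L2" using pq ord by (intro image_eqI[of _ _ p]) auto
        then show ?thesis by blast
      next
        assume "2 * q = m + p"
        then have "A \<in> ?L3" using pq ord by (intro image_eqI[of _ _ q]) auto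
        then show ?thesis by blast
      next
        assume "2 * p = m"
        then have "A \<in> ?L4" using pq ord by (intro image_eqI[of _ _ q]) auto
        then show ?thesis by blast
      next
        assume "2 * q = m"
        then have "A \<in> ?L4" using pq ord by (intro image_eqI[of _ _ p]) auto
        then show ?thesis by blast
      qed
    next
      case False
      then have "card {p, q, m - p, m - q, q - p, m} = 6" using ord by auto
      then have "A \<in> framed 6 m" using frame_2[OF ord] A pq(1) by (simp add: framed_def)
      then show ?thesis by blast
    qed
  qed
  then have "card ?P \<le> card (framed 6 m \<union> ?L1 \<union> ?L2 \<union> ?L3 \<union> ?L4)"
    using L finite_framed by (intro card_mono) auto
  also have "\<dots> \<le> card (framed 6 m) + card ?L1 + card ?L2 + card ?L3 + card ?L4"
    by (intro card_Un_mono order_refl)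
  finally have upper: "2 * int (card ?P) \<le> 2 * int (card (framed 6 m)) + 5 * m + 8"
    using L by linarith
  have "card ?P = card {0<..<m} choose 2" by (rule n_subsets) simp
  then have "card ?P = nat (m - 1) choose 2" by simp
  moreover have "even (nat (m - 1) * (nat (m - 1) - 1))" by auto
  ultimately have "2 * card ?P = nat (m - 1) * (nat (m - 1) - 1)"
    by (simp only: choose_two dvd_mult_div_cancel)
  then have "int (2 * card ?P) = int (nat (m - 1) * (nat (m - 1) - 1))" by (rule arg_cong)
  then have "2 * int (card ?P) = int (nat (m - 1)) * int (nat (m - 1) - 1)"
    by (simp only: of_nat_mult of_nat_numeral)
  also have "\<dots> = (m - 1) * (m - 2)"
    using assms by (cases "m = 1") (auto simp: of_nat_diff)
  finally show ?thesis using upper by linarith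
qed

text \<open>The symmetric frame with points \<open>0, a, m - a, m\<close> has the four differences
  \<open>a\<close>, \<open>m - a\<close>, \<open>m - 2 * a\<close>, \<open>m\<close>. A generic
  further point \<open>y\<close> adds its distances to the four points. There are at least
  \<open>(m - 4) / 2\<close> choices of \<open>a\<close>, and for each at least
  \<open>m - 12\<close> choices of \<open>y\<close>.\<close>

lemma card_framed_8_ge:
  assumes "12 \<le> m"
  shows "(m - 4) * (m - 12) \<le> 2 * int (card (framed 8 m))"
proof -
  \<comment> \<open>The value \<open>3 * a = m\<close> would merge \<open>a\<close> with
    \<open>m - 2 * a\<close>.\<close>
  let ?N = "{t. 0 < t \<and> 2 * t < m} - {m div 3}"
  \<comment> \<open>The points \<open>a\<close> and \<open>m - a\<close> and the eleven-element
    list's other entries exclude repeated points and coincidences among differences. Where a half is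
    not an integer, the rounded value is one more excluded point and does not harm the lower
    bound.\<close>
  let ?X = "\<lambda>a. {a, m - a, m div 2, 2 * a, m - 2 * a, a div 2, m - a div 2, (m - a) div 2,
    (m + a) div 2, 3 * a - m, 2 * m - 3 * a}"
  let ?W = "SIGMA a : ?N. {0<..<m} - ?X a"
  let ?f = "\<lambda>(a, y). {a, m - a, y}"
  have W: "0 < a \<and> 2 * a < m \<and> 3 * a \<noteq> m \<and> 0 < y \<and> y < m \<and> y \<noteq> a \<and> y \<noteq> m - a \<and> 2 * y \<noteq> m
      \<and> y \<noteq> 2 * a \<and> y \<noteq> m - 2 * a \<and> 2 * y \<noteq> a \<and> 2 * y \<noteq> 2 * m - a \<and> 2 * y \<noteq> m - a
      \<and> 2 * y \<noteq> m + a \<and> y \<noteq> 3 * a - m \<and> y \<noteq> 2 * m - 3 * a"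
    if "(a, y) \<in> ?W" for a y
  proof -
    have n: "0 < a" "2 * a < m" "a \<noteq> m div 3" "0 < y" "y < m" "y \<noteq> a" "y \<noteq> m - a" "y \<noteq> m div 2"
      "y \<noteq> 2 * a" "y \<noteq> m - 2 * a" "y \<noteq> a div 2" "y \<noteq> m - a div 2" "y \<noteq> (m - a) div 2"
      "y \<noteq> (m + a) div 2" "y \<noteq> 3 * a - m" "y \<noteq> 2 * m - 3 * a"
      using that by simp_all
    have "3 * a \<noteq> m" using n(3) by auto
    moreover have "2 * y \<noteq> m" using n(8) by auto
    moreover have "2 * y \<noteq> a" using n(11) by auto
    moreover have "2 * y \<noteq> 2 * m - a" using n(12) by presburger
    moreover have "2 * y \<noteq> m - a" using n(13) by presburger
    moreover have "2 * y \<noteq> m + a" using n(14) by presburger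
    ultimately show ?thesis using n by simp
  qed
  have "?f ` ?W \<subseteq> framed 8 m"
  proof
    fix A assume "A \<in> ?f ` ?W"
    then obtain z where z: "z \<in> ?W" "A = ?f z" by blast
    obtain a y where "z = (a, y)" by (cases z)
    then have ay: "(a, y) \<in> ?W" and A: "A = {a, m - a, y}" using z by (simp_all only: prod.case)
    note w = W[OF ay]
    have sub: "A \<subseteq> {0<..<m}" using w A by auto
    have "y \<noteq> a" "y \<noteq> m - a" using w by simp_all
    then consider "y < a" | "a < y" "y < m - a" | "m - a < y" by linarith
    then have "card (pos_diffs (insert 0 (insert m A))) = 8"
    proof cases
      case 1
      have "A = {y, a, m - a}" using A by auto
      moreover have "pos_diffs (insert 0 (insert m {y, a, m - a})) =
          {y, a, m - a, m - y, m - a, m - (m - a), a - y, m - a - y, m - a - a, m}"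
        using 1 w by (intro frame_3) auto
      moreover have "\<dots> = set [y, a, m - a, m - y, a - y, m - a - y, m - 2 * a, m]" by auto
      moreover have "distinct [y, a, m - a, m - y, a - y, m - a - y, m - 2 * a, m]"
        using 1 w unfolding distinct.simps list.set insert_iff empty_iff by (smt (z3))
      ultimately show ?thesis by (simp only: distinct_card list.size)
    next
      case 2
      have "A = {a, y, m - a}" using A by auto
      moreover have "pos_diffs (insert 0 (insert m {a, y, m - a})) =
          {a, y, m - a, m - a, m - y, m - (m - a), y - a, m - a - a, m - a - y, m}"
        using 2 w by (intro frame_3) auto
      moreover have "\<dots> = set [a, y, m - a, m - y, y - a, m - 2 * a, m - a - y, m]" by auto
      moreover have "distinct [a, y, m - a, m - y, y - a, m - 2 * a, m - a - y, m]"
        using 2 w unfolding distinct.simps list.set insert_iff empty_iff by (smt (z3))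
      ultimately show ?thesis by (simp only: distinct_card list.size)
    next
      case 3
      have "A = {a, m - a, y}" using A by auto
      moreover have "pos_diffs (insert 0 (insert m {a, m - a, y})) =
          {a, m - a, y, m - a, m - (m - a), m - y, m - a - a, y - a, y - (m - a), m}"
        using 3 w by (intro frame_3) auto
      moreover have "\<dots> = set [a, m - a, y, m - y, m - 2 * a, y - a, y - (m - a), m]" by auto
      moreover have "distinct [a, m - a, y, m - y, m - 2 * a, y - a, y - (m - a), m]"
        using 3 w unfolding distinct.simps list.set insert_iff empty_iff by (smt (z3))
      ultimately show ?thesis by (simp only: distinct_card list.size)
    qed
    then show "A \<in> framed 8 m" using sub by (simp add: framed_def)
  qed
  then have le: "card (?f ` ?W) \<le> card (framed 8 m)"
    by (intro card_mono finite_framed)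
  have "inj_on ?f ?W"
  proof (rule inj_onI)
    fix u v assume uv: "u \<in> ?W" "v \<in> ?W" "?f u = ?f v"
    obtain a y b z where ab: "u = (a, y)" "v = (b, z)" by (cases u; cases v)
    have "(a, y) \<in> ?W" "(b, z) \<in> ?W" and eq: "{a, m - a, y} = {b, m - b, z}"
      using uv unfolding ab by (simp_all only: prod.case)
    note w = W[OF this(1)] W[OF this(2)]
    \<comment> \<open>The points \<open>a\<close> and \<open>m - a\<close> form the only pair in the
      set with sum \<open>m\<close>, since \<open>m - y\<close> is not in it; so \<open>a\<close> is
      recovered as the smaller of the two.\<close>
    have "b \<in> {a, m - a, y}" "m - b \<in> {a, m - a, y}" unfolding eq by simp_all
    then have "b = a" using w unfolding insert_iff empty_iff by (smt (z3))
    moreover have "y \<in> {b, m - b, z}" unfolding eq[symmetric] by simp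
    ultimately show "u = v" using w ab by simp
  qed
  then have W_card: "card (?f ` ?W) = card ?W" by (rule card_image)
  have fin: "finite ?N"
    by (rule finite_subset[of _ "{0<..<m}"]) auto
  define g where "g a = card ({0<..<m} - ?X a)" for a
  have each: "nat (m - 12) \<le> g a" for a
  proof -
    have le: "card (?X a) \<le> 11"
      using card_length[of "[a, m - a, m div 2, 2 * a, m - 2 * a, a div 2, m - a div 2,
        (m - a) div 2, (m + a) div 2, 3 * a - m, 2 * m - 3 * a]"]
      by simp
    have "nat (m - 12) \<le> card {0<..<m} - 11" by simp
    also have "\<dots> \<le> card {0<..<m} - card (?X a)" by (rule diff_le_mono2[OF le])
    also have "\<dots> \<le> g a" unfolding g_def by (rule diff_card_le_card_Diff) simp
    finally show ?thesis .
  qed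
  have "card ?N * nat (m - 12) = (\<Sum>a \<in> ?N. nat (m - 12))" by simp
  also have "\<dots> \<le> (\<Sum>a \<in> ?N. g a)" using each by (intro sum_mono)
  also have "\<dots> = card ?W" unfolding g_def using fin by (subst card_SigmaI) simp_all
  also have "\<dots> \<le> card (framed 8 m)" using le W_card by simp
  finally have ge: "card ?N * nat (m - 12) \<le> card (framed 8 m)" .
  have "{1..(m - 1) div 2} \<subseteq> {t. 0 < t \<and> 2 * t < m}" by auto
  then have "{1..(m - 1) div 2} - {m div 3} \<subseteq> ?N" by blast
  then have "card ({1..(m - 1) div 2} - {m div 3}) \<le> card ?N" using fin by (intro card_mono)
  moreover have "card {1..(m - 1) div 2} - card {m div 3} \<le> card ({1..(m - 1) div 2} - {m div 3})"
    by (rule diff_card_le_card_Diff) simp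
  ultimately have "card {1..(m - 1) div 2} - card {m div 3} \<le> card ?N" by (rule order_trans[rotated])
  then have "nat ((m - 1) div 2) \<le> card ?N + 1" by simp
  then have "(m - 1) div 2 \<le> int (card ?N) + 1" by linarith
  moreover have "m - 2 \<le> 2 * ((m - 1) div 2)" by presburger
  ultimately have "m - 4 \<le> 2 * int (card ?N)" by linarith
  then have "(m - 4) * (m - 12) \<le> 2 * int (card ?N) * (m - 12)"
    using assms by (intro mult_right_mono) auto
  also have "\<dots> = 2 * int (card ?N * nat (m - 12))" using assms by simp
  also have "\<dots> \<le> 2 * int (card (framed 8 m))"
    by (rule mult_left_mono[OF of_nat_mono[OF ge]]) simp
  finally show ?thesis .
qed

section \<open>Comparison\<close>

text \<open>The growth bounds are applied from width 28 on; below this the counts are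
  evaluated.\<close>

lemma count_framed_4_le_5: "list_all (\<lambda>m. count_framed 4 m \<le> count_framed 5 m) [12..<28]"
  by code_simp

lemma count_framed_7_le_6: "list_all (\<lambda>m. count_framed 7 m \<le> count_framed 6 m) [12..<28]"
  by code_simp

lemma count_framed_7_le_8: "list_all (\<lambda>m. count_framed 7 m \<le> count_framed 8 m) [12..<28]"
  by code_simp

lemma card_framed_le_if_count_le:
  assumes "list_all (\<lambda>m. count_framed l m \<le> count_framed k m) [12..<28]" "12 \<le> m" "m < 28"
  shows "card (framed l (int m)) \<le> card (framed k (int m))"
proof -
  have "count_framed l m \<le> count_framed k m"
    using assms unfolding list_all_iff set_upt by (meson atLeastLessThan_iff)
  then show ?thesis
    using card_framed_eq_count[of m l] card_framed_eq_count[of m k] assms(2) by simp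
qed

lemma framed_tail_le:
  assumes "12 \<le> m"
  shows "card (framed 2 (int m)) \<le> card (framed 1 (int m))"
    and "card (framed 2 (int m)) \<le> card (framed 3 (int m))"
    and "card (framed 4 (int m)) \<le> card (framed 3 (int m))"
    and "card (framed 4 (int m)) \<le> card (framed 5 (int m))"
    and "card (framed 7 (int m)) \<le> card (framed 6 (int m))"
    and "card (framed 7 (int m)) \<le> card (framed 8 (int m))"
proof -
  have pos: "0 < int m" and ge: "12 \<le> int m" using assms by simp_all
  show "card (framed 2 (int m)) \<le> card (framed 1 (int m))"
    using card_framed_1_ge[OF pos] card_framed_2_le[OF pos] by linarith
  show "card (framed 2 (int m)) \<le> card (framed 3 (int m))"
    using card_framed_3_ge[OF pos] card_framed_2_le[OF pos] ge by linarith
  \<comment> \<open>The inequality \<open>2 * (m - 2) \<ge> m + 8\<close> holds exactly from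
    \<open>m = 12\<close> on.\<close>
  show "card (framed 4 (int m)) \<le> card (framed 3 (int m))"
    using card_framed_3_ge[OF pos] card_framed_4_le[OF pos] ge by linarith
  show "card (framed 4 (int m)) \<le> card (framed 5 (int m))"
  proof (cases "m < 28")
    case True
    then show ?thesis using card_framed_le_if_count_le[OF count_framed_4_le_5] assms by simp
  next
    case False
    then have "28 \<le> int m" by simp
    then show ?thesis using card_framed_5_ge[OF pos] card_framed_4_le[OF pos] by linarith
  qed
  show "card (framed 7 (int m)) \<le> card (framed 6 (int m))"
  proof (cases "m < 28")
    case True
    then show ?thesis using card_framed_le_if_count_le[OF count_framed_7_le_6] assms by simp
  next
    case False
    then have m: "28 \<le> int m" by simp
    \<comment> \<open>Bounding one factor below makes the quadratic bound linear: twice the count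
      for 6 then has slope \<open>27 - 5 = 22\<close>, against \<open>26 / 3\<close> for twice the
      count for 7.\<close>
    have "27 * (int m - 2) \<le> (int m - 1) * (int m - 2)" using m by (intro mult_right_mono) auto
    also note card_framed_6_ge[OF pos]
    finally have "27 * int m - 54 \<le> 2 * int (card (framed 6 (int m))) + 5 * int m + 8" by simp
    then show ?thesis using card_framed_7_le[OF pos] m by linarith
  qed
  show "card (framed 7 (int m)) \<le> card (framed 8 (int m))"
  proof (cases "m < 28")
    case True
    then show ?thesis using card_framed_le_if_count_le[OF count_framed_7_le_8] assms by simp
  next
    case False
    then have m: "28 \<le> int m" by simp
    \<comment> \<open>The same linearization, with slope 24 against \<open>26 / 3\<close>.\<close>
    have "24 * (int m - 12) \<le> (int m - 4) * (int m - 12)" using m by (intro mult_right_mono) auto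
    also note card_framed_8_ge[OF ge]
    finally have "24 * int m - 288 \<le> 2 * int (card (framed 8 (int m)))" by simp
    then show ?thesis using card_framed_7_le[OF pos] m by linarith
  qed
qed

lemma P_H_less_if_count:
  assumes "12 \<le> n" "0 < k" "0 < l"
    and tail: "\<And>m. 12 \<le> m \<Longrightarrow> card (framed l (int m)) \<le> card (framed k (int m))"
    and total: "(\<Sum>m \<leftarrow> [1..<12]. count_framed l m) \<le> (\<Sum>m \<leftarrow> [1..<12]. count_framed k m)"
    and weighted: "(\<Sum>m \<leftarrow> [1..<12]. int (12 - m) * count_framed l m)
      < (\<Sum>m \<leftarrow> [1..<12]. int (12 - m) * count_framed k m)"
  shows "P_H n (2 * l + 1) < P_H n (2 * k + 1)"
proof (rule P_H_less[OF assms(1-3) tail])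
  have eq: "int (\<Sum>m = 1..<12. c m * card (framed j (int m))) =
      (\<Sum>m \<leftarrow> [1..<12]. int (c m) * count_framed j m)" for c j
    unfolding interv_sum_list_conv_sum_set_nat set_upt of_nat_sum of_nat_mult
    by (intro sum.cong) (simp_all add: card_framed_eq_count)
  \<comment> \<open>The factor 1 makes the plain total an instance of \<open>eq\<close>.\<close>
  have "int (\<Sum>m = 1..<12. 1 * card (framed l (int m)))
      \<le> int (\<Sum>m = 1..<12. 1 * card (framed k (int m)))"
    unfolding eq using total by (simp only: of_nat_1 mult_1)
  then show "(\<Sum>m = 1..<12. card (framed l (int m))) \<le> (\<Sum>m = 1..<12. card (framed k (int m)))"
    by (simp only: mult_1 of_nat_le_iff)
  have "int (\<Sum>m = 1..<12. (12 - m) * card (framed l (int m)))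
      < int (\<Sum>m = 1..<12. (12 - m) * card (framed k (int m)))"
    unfolding eq by (rule weighted)
  then show "(\<Sum>m = 1..<12. (12 - m) * card (framed l (int m)))
      < (\<Sum>m = 1..<12. (12 - m) * card (framed k (int m)))"
    by (simp only: of_nat_less_iff)
qed

theorem theorem1p1:
  fixes n :: nat
  assumes "n \<ge> 12"
  shows "P_H n 3 > P_H n 5 \<and> P_H n 5 < P_H n 7 \<and>
         P_H n 7 > P_H n 9 \<and> P_H n 9 < P_H n 11 \<and>
         P_H n 13 > P_H n 15 \<and> P_H n 15 < P_H n 17"
proof -
  \<comment> \<open>The minima 5, 9 and 15 correspond to 2, 4 and 7 positive differences. For each
    comparison only the finite sums over widths below 12 remain to be evaluated.\<close>
  have "P_H n (2 * 2 + 1) < P_H n (2 * 1 + 1)"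
    by (rule P_H_less_if_count[OF assms _ _ framed_tail_le(1)],
        simp_all only: zero_less_numeral zero_less_one) code_simp+
  moreover have "P_H n (2 * 2 + 1) < P_H n (2 * 3 + 1)"
    by (rule P_H_less_if_count[OF assms _ _ framed_tail_le(2)], simp_all only: zero_less_numeral)
      code_simp+
  moreover have "P_H n (2 * 4 + 1) < P_H n (2 * 3 + 1)"
    by (rule P_H_less_if_count[OF assms _ _ framed_tail_le(3)], simp_all only: zero_less_numeral)
      code_simp+
  moreover have "P_H n (2 * 4 + 1) < P_H n (2 * 5 + 1)"
    by (rule P_H_less_if_count[OF assms _ _ framed_tail_le(4)], simp_all only: zero_less_numeral)
      code_simp+
  moreover have "P_H n (2 * 7 + 1) < P_H n (2 * 6 + 1)"
    by (rule P_H_less_if_count[OF assms _ _ framed_tail_le(5)], simp_all only: zero_less_numeral)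
      code_simp+
  moreover have "P_H n (2 * 7 + 1) < P_H n (2 * 8 + 1)"
    by (rule P_H_less_if_count[OF assms _ _ framed_tail_le(6)], simp_all only: zero_less_numeral)
      code_simp+
  ultimately show ?thesis by simp
qed

end
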